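(* Let $\Gamma$ be a finitely generated Abelian group of orientation-preserving $C^2$ diffeomorphisms of the circle $\mathbb{S}^1$ acting freely on $\mathbb{S}^1$ (no element other than the identity has a fixed point). Then the projective cocycle $P$ over the action of $\Gamma$ on $\mathbb{S}^1$ is almost $\mathrm{SO}(2,\mathbb{R})$-reducible.
   Context: The circle $\mathbb{S}^1$ is identified with $\mathbb{R}/2\pi\mathbb{Z}$ via $\theta\mapsto e^{i\theta}$. Derivatives $Df, D^2f$ of circle maps are taken with respect to the angle coordinate $\theta$ (via lifts to $\mathbb{R}$). All maps are orientation preserving. $\mathcal{M}$ denotes the group of Möbius transformations of the circle, i.e. the maps $z\mapsto e^{i\kappa}\,\frac{z-\sigma}{1-\bar\sigma z}$ of $\{|z|=1\}$ with $\kappa\in\mathbb{R}$ and $\sigma\in\mathbb{C}$, $|\sigma|<1$; it is identified with $\mathrm{PSL}(2,\mathbb{R})$ as a topological group, and is endowed with a fixed left-invariant metric $d$ inducing its topology. The subgroup of rotations $z\mapsto e^{i\kappa}z$ (the case $\sigma=0$) is denoted $\mathrm{SO}(2,\mathbb{R})$. Projective derivative: for a $C^2$ circle diffeomorphism $f$ and $\theta\in\mathbb{S}^1$, $P_{f,\theta}\in\mathcal{M}$ is the unique Möbius transformation $P$ of the circle with $P(\theta)=f(\theta)$, $DP(\theta)=Df(\theta)$ and $D^2P(\theta)=D^2f(\theta)$. It satisfies the cocycle relation $P_{f,g(\theta)}\circ P_{g,\theta}=P_{fg,\theta}$. For a group $\Gamma$ of $C^2$ circle diffeomorphisms, the projective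 cocycle is the map $(f,\theta)\mapsto P_{f,\theta}$ for $f\in\Gamma$, $\theta\in\mathbb{S}^1$. The projective cocycle over $\Gamma$ is almost $\mathrm{SO}(2,\mathbb{R})$-reducible if there is a sequence of continuous maps $B_n:\mathbb{S}^1\to\mathcal{M}$ such that, for every $f\in\Gamma$, the $d$-distance from $B_n(f(\theta))\circ P_{f,\theta}\circ B_n(\theta)^{-1}$ to the subgroup $\mathrm{SO}(2,\mathbb{R})$ converges to $0$ as $n\to\infty$, uniformly in $\theta\in\mathbb{S}^1$. *)

theory Defs
  imports "HOL-Analysis.Analysis" "HOL-Algebra.Bij" "HOL-Algebra.Generated_Groups"
begin

text \<open>
  The circle is the unit circle in the complex plane. A circle map is an extensional function on
  it (undefined elsewhere), so that equality of circle maps is equality of functions and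
  \<^const>\<open>BijGroup\<close> is the group of all its bijections under composition.
\<close>

abbreviation circle :: "complex set" where
  "circle \<equiv> sphere 0 1"

abbreviation circle_group :: "(complex \<Rightarrow> complex) monoid" where
  "circle_group \<equiv> BijGroup circle"


section \<open>Derivatives with respect to the angle\<close>

definition is_lift :: "(complex \<Rightarrow> complex) \<Rightarrow> (real \<Rightarrow> real) \<Rightarrow> bool" where
  "is_lift f F \<longleftrightarrow> continuous_on UNIV F \<and> (\<forall>t. cis (F t) = f (cis t))"

text \<open>
  Two lifts of a map differ by a constant multiple of \<open>2 * pi\<close>, so derivatives do not depend on the
  lift chosen; for circle homeomorphisms they are moreover \<open>2 * pi\<close>-periodic, hence independent of
  the angle chosen for the base point.
\<close>

definition circle_lift :: "(complex \<Rightarrow> complex) \<Rightarrow> real \<Rightarrow> real" where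
  "circle_lift f = (SOME F. is_lift f F)"

definition circle_deriv :: "(complex \<Rightarrow> complex) \<Rightarrow> complex \<Rightarrow> real" where
  "circle_deriv f z = deriv (circle_lift f) (Arg z)"

definition circle_deriv2 :: "(complex \<Rightarrow> complex) \<Rightarrow> complex \<Rightarrow> real" where
  "circle_deriv2 f z = deriv (deriv (circle_lift f)) (Arg z)"

definition C2_real :: "(real \<Rightarrow> real) \<Rightarrow> bool" where
  "C2_real F \<longleftrightarrow> F differentiable_on UNIV \<and> deriv F differentiable_on UNIV \<and>
     continuous_on UNIV (deriv (deriv F))"

definition C2_circle :: "(complex \<Rightarrow> complex) \<Rightarrow> bool" where
  "C2_circle f \<longleftrightarrow> (\<exists>F. is_lift f F \<and> C2_real F)"

definition orientation_preserving :: "(complex \<Rightarrow> complex) \<Rightarrow> bool" where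
  "orientation_preserving f \<longleftrightarrow> (\<exists>F. is_lift f F \<and> strict_mono F)"

definition C2_circle_diffeos :: "(complex \<Rightarrow> complex) set" where
  "C2_circle_diffeos = {f \<in> carrier circle_group.
     C2_circle f \<and> C2_circle (inv\<^bsub>circle_group\<^esub> f) \<and> orientation_preserving f}"


section \<open>Moebius transformations of the circle\<close>

definition Moebius :: "(complex \<Rightarrow> complex) set" where
  "Moebius = {restrict (\<lambda>z. cis \<kappa> * ((z - \<sigma>) / (1 - cnj \<sigma> * z))) circle |\<kappa> \<sigma>. cmod \<sigma> < 1}"

definition rotations :: "(complex \<Rightarrow> complex) set" where
  "rotations = {restrict (\<lambda>z. cis \<kappa> * z) circle |\<kappa>. True}"

definition SL2R :: "(real^2^2) set" where
  "SL2R = {A. det A = 1}"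

text \<open>
  The action of a real matrix on the real projective line, transported to the circle by the Cayley
  transform \<open>w \<mapsto> (w - \<i>) / (w + \<i>)\<close>. The coefficients below are the entries of
  the conjugate of the matrix by the Cayley matrix; see \<open>SL2R_map_cayley\<close>.
\<close>

definition SL2R_map :: "real^2^2 \<Rightarrow> complex \<Rightarrow> complex" where
  "SL2R_map A = (let \<alpha> = Complex ((A$1$1 + A$2$2) / 2) ((A$1$2 - A$2$1) / 2);
                     \<beta> = Complex ((A$1$1 - A$2$2) / 2) (- (A$1$2 + A$2$1) / 2)
     in restrict (\<lambda>z. (\<alpha> * z + \<beta>) / (cnj \<beta> * z + cnj \<alpha>)) circle)"

text \<open>
  The topology of \<open>PSL(2,R)\<close>, that is, the quotient topology from the subspace topology of
  \<open>SL(2,R)\<close> in the space of real matrices.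
\<close>

definition Moebius_topology :: "(complex \<Rightarrow> complex) topology" where
  "Moebius_topology = topology (\<lambda>U. U \<subseteq> Moebius \<and>
     openin (top_of_set SL2R) {A \<in> SL2R. SL2R_map A \<in> U})"

definition left_invariant_Moebius_metric ::
    "((complex \<Rightarrow> complex) \<Rightarrow> (complex \<Rightarrow> complex) \<Rightarrow> real) \<Rightarrow> bool" where
  "left_invariant_Moebius_metric d \<longleftrightarrow>
     Metric_space Moebius d \<and>
     Metric_space.mtopology Moebius d = Moebius_topology \<and>
     (\<forall>g\<in>Moebius. \<forall>h\<in>Moebius. \<forall>k\<in>Moebius.
        d (g \<otimes>\<^bsub>circle_group\<^esub> h) (g \<otimes>\<^bsub>circle_group\<^esub> k) = d h k)"


section \<open>The projective cocycle\<close>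

definition projective_derivative :: "(complex \<Rightarrow> complex) \<Rightarrow> complex \<Rightarrow> complex \<Rightarrow> complex" where
  "projective_derivative f z = (THE P. P \<in> Moebius \<and> P z = f z \<and>
     circle_deriv P z = circle_deriv f z \<and> circle_deriv2 P z = circle_deriv2 f z)"

definition almost_SO2_reducible ::
    "((complex \<Rightarrow> complex) \<Rightarrow> (complex \<Rightarrow> complex) \<Rightarrow> real) \<Rightarrow> (complex \<Rightarrow> complex) set
     \<Rightarrow> ((complex \<Rightarrow> complex) \<Rightarrow> complex \<Rightarrow> complex \<Rightarrow> complex) \<Rightarrow> bool" where
  "almost_SO2_reducible d \<Gamma> P \<longleftrightarrow>
     (\<exists>B :: nat \<Rightarrow> complex \<Rightarrow> complex \<Rightarrow> complex.
        (\<forall>n. continuous_map (top_of_set circle) Moebius_topology (B n)) \<and>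
        (\<forall>f\<in>\<Gamma>. uniform_limit circle
           (\<lambda>n z. INF r\<in>rotations.
              d (B n (f z) \<otimes>\<^bsub>circle_group\<^esub> P f z \<otimes>\<^bsub>circle_group\<^esub> inv\<^bsub>circle_group\<^esub> (B n z)) r)
           (\<lambda>z. 0) sequentially))"


section \<open>The identification with \<open>PSL(2,R)\<close>\<close>

lemma SL2R_map_cayley:
  fixes A :: "real^2^2" and x :: real
  assumes "A \<in> SL2R" and "A$2$1 * x + A$2$2 \<noteq> 0"
  defines "cayley \<equiv> \<lambda>w::complex. (w - \<i>) / (w + \<i>)"
  shows "SL2R_map A (cayley x) = cayley ((A$1$1 * x + A$1$2) / (A$2$1 * x + A$2$2))"
proof -
  define a b c e where "a = A$1$1" and "b = A$1$2" and "c = A$2$1" and "e = A$2$2"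
  define \<alpha> \<beta> where "\<alpha> = Complex ((a + e) / 2) ((b - c) / 2)"
    and "\<beta> = Complex ((a - e) / 2) (- (b + c) / 2)"
  define y where "y = c * x + e"
  have y: "y \<noteq> 0"
    using assms(2) by (simp add: y_def c_def e_def)
  have xi: "of_real x + \<i> \<noteq> 0"
    by (simp add: complex_eq_iff)
  have "cmod (of_real x - \<i>) = cmod (of_real x + \<i>)"
    by (simp add: cmod_def)
  then have "cayley x \<in> circle"
    using xi by (simp add: cayley_def norm_divide)
  then have "SL2R_map A (cayley x) = (\<alpha> * cayley x + \<beta>) / (cnj \<beta> * cayley x + cnj \<alpha>)"
    by (simp add: SL2R_map_def Let_def \<alpha>_def \<beta>_def a_def b_def c_def e_def)
  also have "\<dots> = ((\<alpha> * cayley x + \<beta>) * (x + \<i>)) / ((cnj \<beta> * cayley x + cnj \<alpha>) * (x + \<i>))"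
    using xi by simp
  also have "(\<alpha> * cayley x + \<beta>) * (x + \<i>) = \<alpha> * (x - \<i>) + \<beta> * (x + \<i>)"
    using xi by (simp add: cayley_def field_simps)
  also have "\<dots> = of_real (a * x + b) - \<i> * y"
    by (simp add: \<alpha>_def \<beta>_def y_def complex_eq_iff field_simps)
  also have "(cnj \<beta> * cayley x + cnj \<alpha>) * (x + \<i>) = cnj \<beta> * (x - \<i>) + cnj \<alpha> * (x + \<i>)"
    using xi by (simp add: cayley_def field_simps)
  also have "\<dots> = of_real (a * x + b) + \<i> * y"
    by (simp add: \<alpha>_def \<beta>_def y_def complex_eq_iff field_simps)
  also have "(of_real (a * x + b) - \<i> * y) / (of_real (a * x + b) + \<i> * y) =
      ((of_real (a * x + b) - \<i> * y) / y) / ((of_real (a * x + b) + \<i> * y) / y)"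
    using y by simp
  also have "\<dots> = cayley ((a * x + b) / y)"
    using y by (simp add: cayley_def diff_divide_distrib add_divide_distrib)
  finally show ?thesis
    by (simp add: a_def b_def c_def e_def y_def)
qed

lemma SL2R_coefficients:
  fixes A :: "real^2^2"
  assumes "A \<in> SL2R"
  obtains \<alpha> \<beta> where "\<alpha> = Complex ((A$1$1 + A$2$2) / 2) ((A$1$2 - A$2$1) / 2)"
    "\<beta> = Complex ((A$1$1 - A$2$2) / 2) (- (A$1$2 + A$2$1) / 2)"
    "SL2R_map A = restrict (\<lambda>z. (\<alpha> * z + \<beta>) / (cnj \<beta> * z + cnj \<alpha>)) circle"
    "(cmod \<alpha>)\<^sup>2 - (cmod \<beta>)\<^sup>2 = 1"
proof
  show "(cmod (Complex ((A$1$1 + A$2$2) / 2) ((A$1$2 - A$2$1) / 2)))\<^sup>2 -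
        (cmod (Complex ((A$1$1 - A$2$2) / 2) (- (A$1$2 + A$2$1) / 2)))\<^sup>2 = 1"
    using assms unfolding cmod_power2 by (simp add: SL2R_def det_2 power2_eq_square field_simps)
qed (simp_all add: SL2R_map_def Let_def)

lemma SL2R_map_in_Moebius:
  assumes "A \<in> SL2R"
  shows "SL2R_map A \<in> Moebius"
proof -
  obtain \<alpha> \<beta> where "\<alpha> = Complex ((A$1$1 + A$2$2) / 2) ((A$1$2 - A$2$1) / 2)"
      "\<beta> = Complex ((A$1$1 - A$2$2) / 2) (- (A$1$2 + A$2$1) / 2)"
    and A: "SL2R_map A = restrict (\<lambda>z. (\<alpha> * z + \<beta>) / (cnj \<beta> * z + cnj \<alpha>)) circle"
    and n: "(cmod \<alpha>)\<^sup>2 - (cmod \<beta>)\<^sup>2 = 1"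
    by (rule SL2R_coefficients[OF assms])
  have "(cmod \<beta>)\<^sup>2 < (cmod \<alpha>)\<^sup>2"
    using n by linarith
  then have lt: "cmod \<beta> < cmod \<alpha>"
    by (simp add: power2_less_imp_less)
  then have nz: "\<alpha> \<noteq> 0"
    by auto
  have rot: "\<alpha> / cnj \<alpha> = cis (2 * Arg \<alpha>)"
  proof -
    have "\<alpha> = of_real (cmod \<alpha>) * cis (Arg \<alpha>)"
      using nz by (simp add: cis_Arg sgn_eq)
    then have "\<alpha> / cnj \<alpha> = (of_real (cmod \<alpha>) * cis (Arg \<alpha>)) / cnj (of_real (cmod \<alpha>) * cis (Arg \<alpha>))"
      by simp
    also have "\<dots> = cis (2 * Arg \<alpha>)"
      using nz by (simp add: cis_cnj cis_divide)
    finally show ?thesis .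
  qed
  have "(\<alpha> * z + \<beta>) / (cnj \<beta> * z + cnj \<alpha>) =
      cis (2 * Arg \<alpha>) * ((z - (- \<beta> / \<alpha>)) / (1 - cnj (- \<beta> / \<alpha>) * z))" for z
  proof -
    have "\<alpha> * z + \<beta> = \<alpha> * (z - (- \<beta> / \<alpha>))" "cnj \<beta> * z + cnj \<alpha> = cnj \<alpha> * (1 - cnj (- \<beta> / \<alpha>) * z)"
      using nz by (simp_all add: field_simps)
    then show ?thesis
      by (simp only: rot[symmetric] times_divide_times_eq)
  qed
  then have "SL2R_map A = restrict (\<lambda>z. cis (2 * Arg \<alpha>) *
      ((z - (- \<beta> / \<alpha>)) / (1 - cnj (- \<beta> / \<alpha>) * z))) circle"
    by (simp only: A)
  moreover have "cmod (- \<beta> / \<alpha>) < 1"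
    using lt nz by (simp add: norm_divide)
  ultimately show ?thesis
    unfolding Moebius_def by blast
qed

lemma SL2R_map_image: "SL2R_map ` SL2R = Moebius"
proof (rule antisym)
  show "SL2R_map ` SL2R \<subseteq> Moebius"
    using SL2R_map_in_Moebius by blast
  show "Moebius \<subseteq> SL2R_map ` SL2R"
  proof
    fix P assume "P \<in> Moebius"
    then obtain \<kappa> \<sigma> where
      P: "P = restrict (\<lambda>z. cis \<kappa> * ((z - \<sigma>) / (1 - cnj \<sigma> * z))) circle" and \<sigma>: "cmod \<sigma> < 1"
      by (auto simp: Moebius_def)
    define s where "s = sqrt (1 - (cmod \<sigma>)\<^sup>2)"
    have s: "s > 0" "s\<^sup>2 = 1 - (cmod \<sigma>)\<^sup>2"
      using \<sigma> by (simp_all add: s_def power_less_one_iff abs_square_less_1 less_imp_le)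
    define \<alpha> where "\<alpha> = cis (\<kappa> / 2) / s"
    define \<beta> where "\<beta> = - \<sigma> * \<alpha>"
    define A :: "real^2^2" where
      "A = vector [vector [Re \<alpha> + Re \<beta>, Im \<alpha> - Im \<beta>], vector [- Im \<alpha> - Im \<beta>, Re \<alpha> - Re \<beta>]]"
    have "det A = (cmod \<alpha>)\<^sup>2 - (cmod \<beta>)\<^sup>2"
      unfolding cmod_power2 by (simp add: A_def det_2 power2_eq_square algebra_simps)
    also have "\<dots> = (1 - (cmod \<sigma>)\<^sup>2) * (cmod \<alpha>)\<^sup>2"
      by (simp add: \<beta>_def norm_mult power_mult_distrib algebra_simps)
    also have "\<dots> = 1"
      using s by (simp add: \<alpha>_def norm_divide power_divide flip: s(2))
    finally have "A \<in> SL2R"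
      by (simp add: SL2R_def)
    moreover have "SL2R_map A = P"
    proof -
      have eqs: "Complex ((A$1$1 + A$2$2) / 2) ((A$1$2 - A$2$1) / 2) = \<alpha>"
        "Complex ((A$1$1 - A$2$2) / 2) (- (A$1$2 + A$2$1) / 2) = \<beta>"
        by (simp_all add: A_def complex_eq_iff)
      have nz: "\<alpha> \<noteq> 0"
        using s by (simp add: \<alpha>_def)
      have "\<alpha> / cnj \<alpha> = cis \<kappa>"
        using s by (simp add: \<alpha>_def cis_cnj cis_divide)
      moreover have "(\<alpha> * z + \<beta>) / (cnj \<beta> * z + cnj \<alpha>) =
          \<alpha> / cnj \<alpha> * ((z - \<sigma>) / (1 - cnj \<sigma> * z))" for z
      proof -
        have "\<alpha> * z + \<beta> = \<alpha> * (z - \<sigma>)" "cnj \<beta> * z + cnj \<alpha> = cnj \<alpha> * (1 - cnj \<sigma> * z)"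
          by (simp_all add: \<beta>_def algebra_simps)
        then show ?thesis
          by (simp only: times_divide_times_eq)
      qed
      ultimately show ?thesis
        unfolding SL2R_map_def Let_def P eqs by (simp only:)
    qed
    ultimately show "P \<in> SL2R_map ` SL2R"
      by blast
  qed
qed

lemma SL2R_map_eq_iff:
  assumes "A \<in> SL2R" "B \<in> SL2R"
  shows "SL2R_map A = SL2R_map B \<longleftrightarrow> A = B \<or> A = - B"
proof
  obtain \<alpha> \<beta> where ab: "\<alpha> = Complex ((A$1$1 + A$2$2) / 2) ((A$1$2 - A$2$1) / 2)"
      "\<beta> = Complex ((A$1$1 - A$2$2) / 2) (- (A$1$2 + A$2$1) / 2)"
    and A: "SL2R_map A = restrict (\<lambda>z. (\<alpha> * z + \<beta>) / (cnj \<beta> * z + cnj \<alpha>)) circle"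
    and nA: "(cmod \<alpha>)\<^sup>2 - (cmod \<beta>)\<^sup>2 = 1"
    by (rule SL2R_coefficients[OF assms(1)])
  obtain \<gamma> \<delta> where cd: "\<gamma> = Complex ((B$1$1 + B$2$2) / 2) ((B$1$2 - B$2$1) / 2)"
      "\<delta> = Complex ((B$1$1 - B$2$2) / 2) (- (B$1$2 + B$2$1) / 2)"
    and B: "SL2R_map B = restrict (\<lambda>z. (\<gamma> * z + \<delta>) / (cnj \<delta> * z + cnj \<gamma>)) circle"
    and nB: "(cmod \<gamma>)\<^sup>2 - (cmod \<delta>)\<^sup>2 = 1"
    by (rule SL2R_coefficients[OF assms(2)])
  have nz: "cnj \<beta> * z + cnj \<alpha> \<noteq> 0" if "(cmod \<alpha>)\<^sup>2 - (cmod \<beta>)\<^sup>2 = 1" "z \<in> circle" for \<alpha> \<beta> z :: complex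
  proof
    assume "cnj \<beta> * z + cnj \<alpha> = 0"
    then have "cnj \<alpha> = - (cnj \<beta> * z)"
      by (simp add: eq_neg_iff_add_eq_0 add.commute)
    then have "cmod (cnj \<alpha>) = cmod (cnj \<beta> * z)"
      by (metis norm_minus_cancel)
    then show False
      using that by (simp add: norm_mult)
  qed
  assume "SL2R_map A = SL2R_map B"
  then have eq: "(\<alpha> * z + \<beta>) * (cnj \<delta> * z + cnj \<gamma>) = (\<gamma> * z + \<delta>) * (cnj \<beta> * z + cnj \<alpha>)"
    if "z \<in> circle" for z
  proof -
    have "SL2R_map A z = SL2R_map B z"
      using \<open>SL2R_map A = SL2R_map B\<close> by simp
    then have "(\<alpha> * z + \<beta>) / (cnj \<beta> * z + cnj \<alpha>) = (\<gamma> * z + \<delta>) / (cnj \<delta> * z + cnj \<gamma>)"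
      by (simp only: A B restrict_apply' that)
    then show ?thesis
      by (simp only: frac_eq_eq[OF nz[OF nA that] nz[OF nB that]])
  qed
  define p q r where "p = \<alpha> * cnj \<delta> - \<gamma> * cnj \<beta>"
    and "q = \<alpha> * cnj \<gamma> + \<beta> * cnj \<delta> - \<gamma> * cnj \<alpha> - \<delta> * cnj \<beta>"
    and "r = \<beta> * cnj \<gamma> - \<delta> * cnj \<alpha>"
  have pqr: "p * (z * z) + q * z + r = 0" if "z \<in> circle" for z
    using eq[OF that] by (simp add: p_def q_def r_def algebra_simps)
  have *: "p + q + r = 0" "p - q + r = 0" "- p + q * \<i> + r = 0"
    using pqr[of 1] pqr[of "- 1"] pqr[of \<i>] by simp_all
  then have q: "q = 0"
    by (simp add: complex_eq_iff)
  then have p: "p = 0"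
    using * by (simp add: complex_eq_iff)
  have na: "\<alpha> \<noteq> 0"
  proof
    assume "\<alpha> = 0"
    then show False
      using nA zero_le_power2[of "cmod \<beta>"] by simp
  qed
  define t where "t = \<gamma> / \<alpha>"
  have g: "\<gamma> = t * \<alpha>"
    using na by (simp add: t_def)
  have "\<alpha> * cnj \<delta> = \<alpha> * (t * cnj \<beta>)"
    using p by (simp add: p_def g algebra_simps)
  then have "cnj \<delta> = t * cnj \<beta>"
    using na by simp
  then have dl: "\<delta> = cnj t * \<beta>"
    by (metis complex_cnj_cnj complex_cnj_mult)
  have "(cnj t - t) * (\<alpha> * cnj \<alpha> - \<beta> * cnj \<beta>) = q"
    by (simp add: q_def g dl algebra_simps)
  moreover have "\<alpha> * cnj \<alpha> - \<beta> * cnj \<beta> = of_real ((cmod \<alpha>)\<^sup>2 - (cmod \<beta>)\<^sup>2)"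
    by (simp only: of_real_diff complex_norm_square)
  ultimately have "cnj t = t"
    using q nA by simp
  then obtain u where u: "t = of_real u"
    by (auto simp: Reals_cnj_iff[symmetric] elim: Reals_cases)
  have "(cmod \<gamma>)\<^sup>2 - (cmod \<delta>)\<^sup>2 = u\<^sup>2 * ((cmod \<alpha>)\<^sup>2 - (cmod \<beta>)\<^sup>2)"
    by (simp add: g dl u norm_mult power_mult_distrib algebra_simps)
  then have "u\<^sup>2 = 1"
    using nA nB by simp
  then have "u = 1 \<or> u = - 1"
    by (simp add: power2_eq_1_iff)
  then show "A = B \<or> A = - B"
  proof
    assume "u = 1"
    then have "\<gamma> = \<alpha>" "\<delta> = \<beta>"
      by (simp_all add: g dl u)
    then have "A = B"
      by (auto simp: ab cd vec_eq_iff forall_2)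
    then show ?thesis ..
  next
    assume "u = - 1"
    then have "\<gamma> = - \<alpha>" "\<delta> = - \<beta>"
      by (simp_all add: g dl u)
    then have "A = - B"
      unfolding vec_eq_iff forall_2 by (simp add: ab cd complex_eq_iff) argo
    then show ?thesis ..
  qed
next
  have *: "SL2R_map (- B) = SL2R_map B"
  proof -
    define \<alpha> \<beta> where "\<alpha> = Complex ((B$1$1 + B$2$2) / 2) ((B$1$2 - B$2$1) / 2)"
      and "\<beta> = Complex ((B$1$1 - B$2$2) / 2) (- (B$1$2 + B$2$1) / 2)"
    have eqs: "Complex (((- B)$1$1 + (- B)$2$2) / 2) (((- B)$1$2 - (- B)$2$1) / 2) = - \<alpha>"
      "Complex (((- B)$1$1 - (- B)$2$2) / 2) (- ((- B)$1$2 + (- B)$2$1) / 2) = - \<beta>"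
      by (simp_all add: \<alpha>_def \<beta>_def complex_eq_iff field_simps)
    have "(- \<alpha> * z + - \<beta>) / (cnj (- \<beta>) * z + cnj (- \<alpha>)) = (\<alpha> * z + \<beta>) / (cnj \<beta> * z + cnj \<alpha>)" for z
    proof -
      have "- \<alpha> * z + - \<beta> = - (\<alpha> * z + \<beta>)" "cnj (- \<beta>) * z + cnj (- \<alpha>) = - (cnj \<beta> * z + cnj \<alpha>)"
        by simp_all
      then show ?thesis
        by (simp only: minus_divide_divide)
    qed
    then show ?thesis
      unfolding SL2R_map_def Let_def eqs by (simp only: \<alpha>_def \<beta>_def)
  qed
  assume "A = B \<or> A = - B"
  then show "SL2R_map A = SL2R_map B"
    using * by auto
qed

lemma openin_Moebius_topology:
  "openin Moebius_topology U \<longleftrightarrow>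
     U \<subseteq> Moebius \<and> openin (top_of_set SL2R) {A \<in> SL2R. SL2R_map A \<in> U}"
proof -
  have "istopology (\<lambda>U. U \<subseteq> Moebius \<and> openin (top_of_set SL2R) {A \<in> SL2R. SL2R_map A \<in> U})"
    unfolding istopology_def
  proof (intro conjI allI impI; (elim conjE)?)
    fix U V assume "openin (top_of_set SL2R) {A \<in> SL2R. SL2R_map A \<in> U}"
      "openin (top_of_set SL2R) {A \<in> SL2R. SL2R_map A \<in> V}"
    then have "openin (top_of_set SL2R)
        ({A \<in> SL2R. SL2R_map A \<in> U} \<inter> {A \<in> SL2R. SL2R_map A \<in> V})"
      by (rule openin_Int)
    also have "{A \<in> SL2R. SL2R_map A \<in> U} \<inter> {A \<in> SL2R. SL2R_map A \<in> V} =
        {A \<in> SL2R. SL2R_map A \<in> U \<inter> V}"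
      by auto
    finally show "openin (top_of_set SL2R) {A \<in> SL2R. SL2R_map A \<in> U \<inter> V}" .
  next
    fix K assume "\<forall>U\<in>K. U \<subseteq> Moebius \<and> openin (top_of_set SL2R) {A \<in> SL2R. SL2R_map A \<in> U}"
    then have "openin (top_of_set SL2R) (\<Union>U\<in>K. {A \<in> SL2R. SL2R_map A \<in> U})"
      by blast
    also have "(\<Union>U\<in>K. {A \<in> SL2R. SL2R_map A \<in> U}) = {A \<in> SL2R. SL2R_map A \<in> \<Union>K}"
      by auto
    finally show "openin (top_of_set SL2R) {A \<in> SL2R. SL2R_map A \<in> \<Union>K}" .
  qed auto
  then show ?thesis
    by (simp add: Moebius_topology_def)
qed

lemma quotient_map_SL2R_map: "quotient_map (top_of_set SL2R) Moebius_topology SL2R_map"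
proof -
  have "topspace Moebius_topology = Moebius"
  proof (rule antisym)
    show "topspace Moebius_topology \<subseteq> Moebius"
      using openin_Moebius_topology openin_topspace by blast
    have "{A \<in> SL2R. SL2R_map A \<in> Moebius} = SL2R"
      using SL2R_map_image by blast
    then show "Moebius \<subseteq> topspace Moebius_topology"
      by (intro openin_subset) (simp add: openin_Moebius_topology)
  qed
  then show ?thesis
    by (simp add: quotient_map_def SL2R_map_image openin_Moebius_topology)
qed

end

theory Submission
  imports Defs
begin

text \<open>
  Rotating \<open>\<theta>\<close> and \<open>f \<theta>\<close> to a common base point turns \<open>P\<^bsub>f,\<theta>\<^esub>\<close> into an element of the stabiliser of
  that point in the Moebius group, that is, in the half-plane model, into an upper triangular matrix
  with diagonal \<open>p, 1/p\<close> and corner \<open>q\<close>, where \<open>p = Df(\<theta>) powr (- 1/2)\<close> and \<open>q = D\<^sup>2f(\<theta>) * p ^ 3\<close>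
  (\<open>projective_derivative_eq_framed\<close>). Conjugating this triangular cocycle by a diagonal one with
  entries \<open>exp (w \<theta>)\<close> and \<open>exp (- w \<theta>)\<close> multiplies the corner by \<open>exp (w (f \<theta>) + w \<theta>)\<close> and
  replaces \<open>log Df\<close>, which is minus twice the logarithm of the diagonal, by a cohomologous cocycle.
  Adding to \<open>w\<close> a very negative constant leaves the diagonal alone and makes the corner as small as
  desired. Hence only the diagonal matters: it suffices to find continuous functions \<open>u\<^sub>n\<close> on the
  circle such that \<open>log Df + u\<^sub>n \<circ> f - u\<^sub>n\<close> tends to \<open>0\<close> uniformly for every \<open>f\<close> in the group, and then
  the conjugated cocycle tends to the identity (\<open>almost_reducible\<close>).

  Since the group is Abelian and finitely generated, such functions arise by averaging along one
  generator after the other (\<open>almost_coboundary\<close>), provided that \<open>(1/N) log Df\<^sup>N\<close> tends to \<open>0\<close>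
  uniformly for every \<open>f\<close> in the group (\<open>log_deriv_growth\<close>).

  This is where freeness enters. If \<open>log Df\<^sup>N (x) \<le> - \<delta> N\<close> for a large \<open>N\<close>, then along the orbit of \<open>x\<close>
  there are many times from which on \<open>f\<close> contracts at a definite exponential rate; they are the times
  at which \<open>log Df\<^sup>i (x) + \<delta> i / 2\<close> is larger than at all later times (\<open>many_final_maxima\<close>). Two of
  the corresponding points of the orbit are close to each other, by compactness, so that some power
  of \<open>f\<close> maps an arc of a fixed size into itself by a contraction
  (\<open>contraction_near_hyperbolic_orbit\<close>). This power has a fixed point, hence it is the identity, hence
  it contracts nothing (\<open>Birkhoff_sum_lower_bound\<close>). The upper bound is the lower bound for the
  inverse of \<open>f\<close>.
\<close>

section \<open>Growth of derivatives and periodic points\<close>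

definition Birkhoff_sum :: "('a \<Rightarrow> 'a) \<Rightarrow> ('a \<Rightarrow> real) \<Rightarrow> nat \<Rightarrow> 'a \<Rightarrow> real" where
  "Birkhoff_sum f \<phi> n x = (\<Sum>i<n. \<phi> ((f ^^ i) x))"

lemma Birkhoff_sum_0 [simp]: "Birkhoff_sum f \<phi> 0 x = 0"
  by (simp add: Birkhoff_sum_def)

lemma Birkhoff_sum_Suc [simp]:
  "Birkhoff_sum f \<phi> (Suc n) x = Birkhoff_sum f \<phi> n x + \<phi> ((f ^^ n) x)"
  by (simp add: Birkhoff_sum_def)

lemma Birkhoff_sum_add:
  "Birkhoff_sum f \<phi> (m + n) x = Birkhoff_sum f \<phi> m x + Birkhoff_sum f \<phi> n ((f ^^ m) x)"
proof (induction n)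
  case (Suc n)
  have "(f ^^ (m + n)) x = (f ^^ n) ((f ^^ m) x)"
    by (metis add.commute comp_apply funpow_add)
  with Suc show ?case by simp
qed simp

lemma dist_cis_le: "dist (cis s) (cis t) \<le> \<bar>s - t\<bar>"
proof -
  have "cis s - cis t = cis t * (cis (s - t) - 1)"
    by (simp add: algebra_simps cis_mult)
  then have "dist (cis s) (cis t) = norm (exp (\<i> * of_real (s - t)) - 1)"
    by (simp add: dist_norm norm_mult cis_conv_exp)
  also have "\<dots> = 2 * \<bar>sin ((s - t) / 2)\<bar>"
    by (rule dist_exp_i_1)
  also have "\<dots> \<le> \<bar>s - t\<bar>"
    using abs_sin_x_le_abs_x[of "(s - t) / 2"] by simp
  finally show ?thesis .
qed

lemma has_derivative_funpow_exp:
  assumes deriv: "\<And>t. (G has_real_derivative exp (\<phi> t)) (at t)"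
  shows "((G ^^ n) has_real_derivative exp (Birkhoff_sum G \<phi> n t)) (at t)"
proof (induction n)
  case 0
  then show ?case by (simp add: id_def)
next
  case (Suc n)
  from DERIV_chain[OF deriv this] show ?case
    by (simp add: exp_add mult.commute o_def)
qed

text \<open>
  As long as the orbits of \<open>s\<close> and \<open>z\<close> stay within \<open>r\<close> of each other, the logarithmic derivatives along
  them differ by at most \<open>c / 2\<close> per step, so half of the contraction rate at \<open>z\<close> survives on the whole
  interval of radius \<open>r\<close>; the mean value theorem turns this into the contraction of distances that
  keeps the orbits together for one more step.
\<close>

lemma contraction_near_hyperbolic_orbit:
  fixes G \<phi> :: "real \<Rightarrow> real"
  assumes deriv: "\<And>t. (G has_real_derivative exp (\<phi> t)) (at t)"
    and osc: "\<And>s t. \<bar>s - t\<bar> \<le> r \<Longrightarrow> \<bar>\<phi> s - \<phi> t\<bar> \<le> c / 2"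
    and "c \<ge> 0"
    and hyp: "\<And>n. n \<le> m \<Longrightarrow> Birkhoff_sum G \<phi> n z \<le> - c * n"
    and "n \<le> m" "\<bar>s - z\<bar> \<le> r"
  shows "\<bar>(G ^^ n) s - (G ^^ n) z\<bar> \<le> r * exp (- c * n / 2)"
  using \<open>n \<le> m\<close> \<open>\<bar>s - z\<bar> \<le> r\<close>
proof (induction n arbitrary: s rule: less_induct)
  case (less n)
  have "r \<ge> 0" using less.prems by linarith
  have close: "\<bar>(G ^^ i) y - (G ^^ i) z\<bar> \<le> r" if "i < n" "\<bar>y - z\<bar> \<le> r" for i y
  proof -
    have "\<bar>(G ^^ i) y - (G ^^ i) z\<bar> \<le> r * exp (- c * i / 2)"
      using less.IH[OF that(1) _ that(2)] less.prems that by simp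
    also have "\<dots> \<le> r * 1"
      using \<open>r \<ge> 0\<close> \<open>c \<ge> 0\<close> by (intro mult_left_mono) auto
    finally show ?thesis by simp
  qed
  have deriv_le: "exp (Birkhoff_sum G \<phi> n y) \<le> exp (- c * n / 2)" if "\<bar>y - z\<bar> \<le> r" for y
  proof -
    have "Birkhoff_sum G \<phi> n y - Birkhoff_sum G \<phi> n z \<le> (\<Sum>i<n. c / 2)"
      unfolding Birkhoff_sum_def sum_subtractf[symmetric]
    proof (rule sum_mono)
      fix i assume "i \<in> {..<n}"
      then show "\<phi> ((G ^^ i) y) - \<phi> ((G ^^ i) z) \<le> c / 2"
        using order_trans[OF abs_ge_self osc[OF close[OF _ that, of i]]] by simp
    qed
    then have "Birkhoff_sum G \<phi> n y - Birkhoff_sum G \<phi> n z \<le> c * n / 2" by (simp add: mult.commute)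
    with hyp[OF less.prems(1)] show ?thesis by simp
  qed
  have "norm ((G ^^ n) s - (G ^^ n) z) \<le> exp (- c * n / 2) * norm (s - z)"
  proof (rule field_differentiable_bound[of "{z - r..z + r}"])
    show "((G ^^ n) has_field_derivative exp (Birkhoff_sum G \<phi> n y)) (at y within {z - r..z + r})" for y
      using has_derivative_funpow_exp[OF deriv] DERIV_subset by blast
    show "norm (exp (Birkhoff_sum G \<phi> n y)) \<le> exp (- c * n / 2)" if "y \<in> {z - r..z + r}" for y
      using deriv_le[of y] that by (simp add: abs_if split: if_splits)
  qed (use less.prems in auto)
  also have "\<dots> \<le> exp (- c * n / 2) * r"
    using less.prems by (intro mult_left_mono) auto
  finally show ?case by (simp add: mult.commute)
qed

text \<open>
  The last times at which \<open>a\<close> is at least \<open>0\<close>, \<open>- C\<close>, \<open>- 2 * C\<close>, \<open>\<dots>\<close> dominate all later times by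
  construction, and they are distinct because \<open>a\<close> cannot fall by \<open>C\<close> in one step. For
  \<open>a i = log DG\<^sup>i(x) + c * i\<close> they are the times from which on the orbit of \<open>x\<close> contracts at rate \<open>c\<close>.
\<close>

lemma many_final_maxima:
  fixes a :: "nat \<Rightarrow> real" and C :: real and M N :: nat
  assumes "a 0 = 0" and step: "\<And>i. a (Suc i) > a i - C" and "C > 0" and "a N < - (M * C)"
  shows "\<exists>\<tau>. (\<forall>k\<le>M. \<tau> k < N) \<and> (\<forall>k l. k < l \<longrightarrow> l \<le> M \<longrightarrow> \<tau> k < \<tau> l) \<and>
    (\<forall>k\<le>M. \<forall>j. \<tau> k \<le> j \<longrightarrow> j \<le> N \<longrightarrow> a j \<le> a (\<tau> k))"
proof -
  define T where "T k = {i. i \<le> N \<and> a i \<ge> - (k * C)}" for k :: nat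
  define \<tau> where "\<tau> k = Max (T k)" for k
  have fin: "finite (T k)" for k by (simp add: T_def)
  have ne: "T k \<noteq> {}" for k
    using assms(1,3) by (auto simp: T_def intro!: exI[of _ 0])
  have mem: "\<tau> k \<in> T k" for k
    unfolding \<tau>_def using fin ne by (rule Max_in)
  have above: "j \<le> \<tau> k" if "j \<in> T k" for j k
    unfolding \<tau>_def using fin that by (rule Max_ge)
  have lt: "\<tau> k < N" if "k \<le> M" for k
  proof -
    have "real k * C \<le> M * C" using that \<open>C > 0\<close> by simp
    then have "\<tau> k \<noteq> N" using mem[of k] assms(4) by (auto simp: T_def)
    then show ?thesis using mem[of k] by (auto simp: T_def)
  qed
  have inc: "\<tau> k < \<tau> l" if "k < l" "l \<le> M" for k l
  proof -
    have "a (Suc (\<tau> k)) > - (k * C) - C"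
      using mem[of k] step[of "\<tau> k"] by (auto simp: T_def)
    moreover have "real (Suc k) * C \<le> l * C" using that \<open>C > 0\<close> by (intro mult_right_mono) auto
    ultimately have "Suc (\<tau> k) \<in> T l"
      using lt[of k] that by (auto simp: T_def algebra_simps)
    then show ?thesis using above by fastforce
  qed
  have max: "a j \<le> a (\<tau> k)" if "k \<le> M" "\<tau> k \<le> j" "j \<le> N" for k j
  proof (cases "j = \<tau> k")
    case False
    then have "j \<notin> T k" using above[of j k] that by auto
    then have "a j < - (k * C)" using that by (auto simp: T_def)
    then show ?thesis using mem[of k] by (auto simp: T_def)
  qed simp
  show ?thesis using lt inc max by blast
qed

text \<open>
  This finds, among the times given by \<open>many_final_maxima\<close>, two at which the orbit on the circle is
  nearly at the same point.
\<close>

lemma pigeonhole_mod_2pi: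
  fixes p :: "nat \<Rightarrow> real"
  assumes "M > 0"
  obtains k l q where "k < l" "l \<le> M" "\<bar>p l - p k - 2 * pi * of_int q\<bar> < 2 * pi / M"
proof -
  define cell where "cell k = \<lfloor>real M * frac (p k / (2 * pi))\<rfloor>" for k
  have "cell ` {..M} \<subseteq> {0..<int M}"
  proof safe
    fix k
    have "real M * frac (p k / (2 * pi)) < real M * 1"
      using assms by (intro mult_strict_left_mono frac_lt_1) auto
    then show "cell k \<in> {0..<int M}"
      by (simp add: cell_def floor_less_iff)
  qed
  then have "card (cell ` {..M}) \<le> card {0..<int M}"
    by (rule card_mono[rotated]) simp
  also have "\<dots> < card {..M}" by simp
  finally have "\<not> inj_on cell {..M}" by (rule pigeonhole)
  then obtain k l where kl: "k < l" "l \<le> M" "cell k = cell l"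
    unfolding inj_on_def by (metis atMost_iff linorder_neqE_nat)
  (* the difference of the numbers of full turns *)
  define q where "q = \<lfloor>p l / (2 * pi)\<rfloor> - \<lfloor>p k / (2 * pi)\<rfloor>"
  have "\<bar>M * frac (p l / (2 * pi)) - M * frac (p k / (2 * pi))\<bar> < 1"
    using kl(3) unfolding cell_def by linarith
  also have "M * frac (p l / (2 * pi)) - M * frac (p k / (2 * pi)) =
      M / (2 * pi) * (p l - p k - 2 * pi * of_int q)"
    by (simp add: frac_def q_def field_simps)
  finally have "M / (2 * pi) * \<bar>p l - p k - 2 * pi * of_int q\<bar> < 1"
    by (simp add: abs_mult)
  then have "\<bar>p l - p k - 2 * pi * of_int q\<bar> < 2 * pi / M"
    using assms by (simp add: field_simps)
  with kl(1,2) show ?thesis by (rule that)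
qed

text \<open>
  Here \<open>G\<close> is a lift of a circle map with derivative \<open>exp \<psi>\<close>, and the third assumption says that a power
  of this map with a fixed point is the identity. A violation of the bound produces a power of the map
  that contracts an arc of radius \<open>r\<close> into itself, hence has a fixed point without being the identity.
  The interplay of constants: \<open>r\<close> depends on the modulus of continuity of \<open>\<psi>\<close>, the precision \<open>\<eta>\<close> of the
  return on \<open>r\<close>, the number \<open>M\<close> of cells on \<open>\<eta>\<close>, and the length \<open>N0\<close> of the orbit on \<open>M\<close>.
\<close>

lemma Birkhoff_sum_lower_bound:
  fixes G :: "real \<Rightarrow> real" and \<psi> :: "complex \<Rightarrow> real"
  assumes cont: "continuous_on circle \<psi>"
    and deriv: "\<And>t. (G has_real_derivative exp (\<psi> (cis t))) (at t)"
    and per: "\<And>m q s. m > 0 \<Longrightarrow> (G ^^ m) s = s + 2 * pi * of_int q \<Longrightarrow>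
                \<forall>t. (G ^^ m) t = t + 2 * pi * of_int q"
    and "\<delta> > 0"
  shows "\<exists>N0. \<forall>N\<ge>N0. \<forall>x. Birkhoff_sum G (\<lambda>t. \<psi> (cis t)) N x > - \<delta> * N"
proof -
  define \<phi> where "\<phi> t = \<psi> (cis t)" for t
  note deriv = deriv[folded \<phi>_def]
  define c where "c = \<delta> / 2"
  have "c > 0" using \<open>\<delta> > 0\<close> by (simp add: c_def)
  have "compact (\<psi> ` circle)"
    using cont by (intro compact_continuous_image) auto
  then obtain C0 where C0: "\<And>z. z \<in> circle \<Longrightarrow> \<bar>\<psi> z\<bar> \<le> C0"
    using compact_imp_bounded[of "\<psi> ` circle"] unfolding bounded_iff by (metis imageI real_norm_def)
  (* one more than the bound, so that a step never falls by the full amount C *)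
  define C where "C = \<bar>C0\<bar> + 1"
  have "C > 0" by (simp add: C_def)
  have \<phi>_bound: "\<phi> t > - C" for t
    using C0[of "cis t"] by (simp add: C_def \<phi>_def)
  have "uniformly_continuous_on circle \<psi>"
    using cont by (intro compact_uniformly_continuous) auto
  then obtain e where e: "e > 0" "\<And>w z. w \<in> circle \<Longrightarrow> z \<in> circle \<Longrightarrow> dist w z < e \<Longrightarrow> dist (\<psi> w) (\<psi> z) < c / 2"
    unfolding uniformly_continuous_on_def by (meson \<open>c > 0\<close> half_gt_zero)
  define r where "r = e / 2"
  have "r > 0" using e by (simp add: r_def)
  have osc: "\<bar>\<phi> s - \<phi> t\<bar> \<le> c / 2" if "\<bar>s - t\<bar> \<le> r" for s t
    using e(2)[of "cis s" "cis t"] dist_cis_le[of s t] that e(1) by (simp add: r_def \<phi>_def dist_real_def)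
  define \<eta> where "\<eta> = r * (1 - exp (- c / 2))"
  have "\<eta> > 0" using \<open>r > 0\<close> \<open>c > 0\<close> by (simp add: \<eta>_def)
  obtain M :: nat where M: "M > 2 * pi / \<eta>" using reals_Archimedean2 by blast
  have "M > 0" using M \<open>\<eta> > 0\<close> by (metis divide_pos_pos gr0I less_asym of_nat_0 pi_gt_zero zero_less_mult_iff zero_less_numeral)
  have M\<eta>: "2 * pi / M < \<eta>" using M \<open>M > 0\<close> \<open>\<eta> > 0\<close> by (simp add: field_simps)
  obtain N0 :: nat where N0: "N0 > M * C / c" using reals_Archimedean2 by blast
  show ?thesis
  proof (intro exI[of _ N0] allI impI)
    fix N x assume "N \<ge> N0"
    show "Birkhoff_sum G (\<lambda>t. \<psi> (cis t)) N x > - \<delta> * N"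
      unfolding \<phi>_def[symmetric]
    proof (rule ccontr)
      assume "\<not> Birkhoff_sum G \<phi> N x > - \<delta> * N"
      then have neg: "Birkhoff_sum G \<phi> N x \<le> - \<delta> * N" by simp
      define a where "a i = Birkhoff_sum G \<phi> i x + c * i" for i
      have "a N \<le> - (c * N)" using neg by (simp add: a_def c_def)
      also have "\<dots> \<le> - (c * N0)" using \<open>N \<ge> N0\<close> \<open>c > 0\<close> by simp
      also have "\<dots> < - (M * C)" using N0 \<open>c > 0\<close> by (simp add: field_simps)
      finally have aN: "a N < - (M * C)" .
      have a0: "a 0 = 0" by (simp add: a_def)
      have a_step: "a (Suc i) > a i - C" for i
        using \<phi>_bound[of "(G ^^ i) x"] \<open>c > 0\<close> by (simp add: a_def algebra_simps)
      from many_final_maxima[OF a0 a_step \<open>C > 0\<close> aN]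
      obtain \<tau> where "\<forall>k\<le>M. \<tau> k < N" "\<forall>k l. k < l \<longrightarrow> l \<le> M \<longrightarrow> \<tau> k < \<tau> l"
          "\<forall>k\<le>M. \<forall>j. \<tau> k \<le> j \<longrightarrow> j \<le> N \<longrightarrow> a j \<le> a (\<tau> k)"
        by (elim exE conjE)
      note \<tau> = this[rule_format]
      obtain k l q where kl: "k < l" "l \<le> M"
        and q: "\<bar>(G ^^ \<tau> l) x - (G ^^ \<tau> k) x - 2 * pi * of_int q\<bar> < 2 * pi / M"
        using pigeonhole_mod_2pi[OF \<open>M > 0\<close>, of "\<lambda>k. (G ^^ \<tau> k) x"] by blast
      define z where "z = (G ^^ \<tau> k) x"
      define m where "m = \<tau> l - \<tau> k"
      have "m > 0" using \<tau>(2)[OF kl] by (simp add: m_def)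
      have ret: "(G ^^ m) z = (G ^^ \<tau> l) x"
        unfolding z_def m_def using \<tau>(2)[OF kl] by (metis comp_apply funpow_add le_add_diff_inverse2 less_imp_le)
      have hyp: "Birkhoff_sum G \<phi> n z \<le> - c * n" if "n \<le> m" for n
      proof -
        have "a (\<tau> k + n) \<le> a (\<tau> k)"
          using that kl \<tau>(1)[OF kl(2)] \<tau>(2)[OF kl] by (intro \<tau>(3)) (auto simp: m_def)
        then show ?thesis
          using Birkhoff_sum_add[of G \<phi> "\<tau> k" n x] by (simp add: a_def z_def algebra_simps)
      qed
      have contr: "\<bar>(G ^^ m) s - (G ^^ m) z\<bar> \<le> r * exp (- c / 2)" if "\<bar>s - z\<bar> \<le> r" for s
      proof -
        have "\<bar>(G ^^ m) s - (G ^^ m) z\<bar> \<le> r * exp (- c * m / 2)"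
          using that \<open>c > 0\<close>
          by (intro contraction_near_hyperbolic_orbit[where G = G and \<phi> = \<phi> and m = m] deriv osc hyp) auto
        also have "\<dots> \<le> r * exp (- c / 2)"
          using \<open>r > 0\<close> \<open>c > 0\<close> \<open>m > 0\<close> by (intro mult_left_mono) auto
        finally show ?thesis .
      qed
      (* the image of the interval has radius r * exp (- c / 2), and its centre is off by less than
         eta = r - r * exp (- c / 2) *)
      have self_map: "\<bar>(G ^^ m) s - (z + 2 * pi * of_int q)\<bar> \<le> r" if "\<bar>s - z\<bar> \<le> r" for s
        using contr[OF that] q M\<eta> unfolding ret[symmetric] z_def[symmetric] by (simp add: \<eta>_def algebra_simps)
      define H where "H s = (G ^^ m) s - s - 2 * pi * of_int q" for s
      have "continuous_on {z - r..z + r} H"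
        unfolding H_def
        using has_derivative_funpow_exp[OF deriv, of m] DERIV_isCont
        by (intro continuous_intros continuous_at_imp_continuous_on) blast
      moreover have "H (z + r) \<le> 0" "H (z - r) \<ge> 0"
        using self_map[of "z + r"] self_map[of "z - r"] \<open>r > 0\<close> unfolding H_def by (auto simp: abs_if split: if_splits)
      ultimately obtain s where "H s = 0"
        using IVT2'[of H "z + r" 0 "z - r"] \<open>r > 0\<close> by auto
      then have "(G ^^ m) s = s + 2 * pi * of_int q" by (simp add: H_def)
      with per[OF \<open>m > 0\<close>] have "\<And>t. (G ^^ m) t = t + 2 * pi * of_int q" by blast
      then have "r \<le> r * exp (- c / 2)"
        using contr[of "z + r"] \<open>r > 0\<close> by simp
      then show False using \<open>r > 0\<close> \<open>c > 0\<close> by simp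
    qed
  qed
qed

section \<open>Almost coboundaries\<close>

text \<open>
  The functions \<open>\<l> f\<close> are the values of an additive cocycle over commuting maps. Given a solution \<open>u\<close>
  for the maps in \<open>B\<close>, its average along the orbits of one more map \<open>g\<close>, twisted by the cocycle of the
  powers of \<open>g\<close>, is a solution for \<open>g\<close> as well: the defect for \<open>g\<close> telescopes to a boundary term divided by \<open>N\<close>,
  and the defect for each \<open>f\<close> in \<open>B\<close> is, by commutation, an average of old defects.
\<close>

lemma almost_coboundary:
  fixes A :: "('a::topological_space \<Rightarrow> 'a) set" and \<l> :: "('a \<Rightarrow> 'a) \<Rightarrow> 'a \<Rightarrow> real"
  assumes "compact X" and "finite A" 
    and maps: "\<And>f. f \<in> A \<Longrightarrow> f ` X \<subseteq> X"
    and cont: "\<And>f. f \<in> A \<Longrightarrow> continuous_on X f"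
    and cont_\<l>: "\<And>f. f \<in> A \<Longrightarrow> continuous_on X (\<l> f)"
    and comm: "\<And>f g x. f \<in> A \<Longrightarrow> g \<in> A \<Longrightarrow> x \<in> X \<Longrightarrow> f (g x) = g (f x)"
    and coc: "\<And>f g x. f \<in> A \<Longrightarrow> g \<in> A \<Longrightarrow> x \<in> X \<Longrightarrow> \<l> f (g x) + \<l> g x = \<l> g (f x) + \<l> f x"
    and drift: "\<And>f (e :: real). f \<in> A \<Longrightarrow> e > 0 \<Longrightarrow>
        \<exists>N0. \<forall>N\<ge>N0. \<forall>x\<in>X. \<bar>Birkhoff_sum f (\<l> f) N x\<bar> \<le> e * N"
    and "\<epsilon> > 0"
  shows "\<exists>u. continuous_on X u \<and> (\<forall>f\<in>A. \<forall>x\<in>X. \<bar>\<l> f x + u (f x) - u x\<bar> \<le> \<epsilon>)"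
proof -
  have "\<exists>u. continuous_on X u \<and> (\<forall>f\<in>B. \<forall>x\<in>X. \<bar>\<l> f x + u (f x) - u x\<bar> \<le> \<epsilon>)" if "B \<subseteq> A" for B
    using finite_subset[OF that \<open>finite A\<close>] that
  proof (induction B rule: finite_induct)
    case empty
    show ?case by (auto intro: continuous_on_const)
  next
    case (insert g B)
    then obtain u where u: "continuous_on X u"
        and small: "\<And>f x. f \<in> B \<Longrightarrow> x \<in> X \<Longrightarrow> \<bar>\<l> f x + u (f x) - u x\<bar> \<le> \<epsilon>"
      by auto
    have g: "g \<in> A" and B: "B \<subseteq> A" using insert.prems by auto
    have gX: "(g ^^ i) x \<in> X" if "x \<in> X" for i x
      using maps[OF g] that by (induction i) auto
    have cont_gi: "continuous_on X (g ^^ i)" for i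
    proof (induction i)
      case 0 then show ?case by (simp add: id_def)
    next
      case (Suc i)
      then show ?case
        using continuous_on_compose[of X "g ^^ i" g] continuous_on_subset[OF cont[OF g]] gX
        by (auto simp: image_subset_iff)
    qed
    have compose_gi: "continuous_on X (\<lambda>x. w ((g ^^ i) x))" if "continuous_on X w" for w :: "'a \<Rightarrow> real" and i
      by (rule continuous_on_compose2[OF that cont_gi]) (use gX in auto)
    obtain U where U: "\<And>x. x \<in> X \<Longrightarrow> \<bar>u x\<bar> \<le> U"
      using compact_imp_bounded[OF compact_continuous_image[OF u \<open>compact X\<close>]]
      unfolding bounded_iff by (metis imageI real_norm_def)
    obtain N0 where N0: "\<And>N x. N \<ge> N0 \<Longrightarrow> x \<in> X \<Longrightarrow> \<bar>Birkhoff_sum g (\<l> g) N x\<bar> \<le> \<epsilon> / 2 * N"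
      using drift[OF g, of "\<epsilon> / 2"] \<open>\<epsilon> > 0\<close> by auto
    obtain N1 :: nat where N1: "N1 > 4 * U / \<epsilon>" using reals_Archimedean2 by blast
    define N where "N = max (max N0 N1) 1"
    have N: "N \<ge> N0" "N > 0" by (auto simp: N_def)
    have "4 * U \<le> \<epsilon> * N1" using N1 \<open>\<epsilon> > 0\<close> by (simp add: field_simps)
    also have "\<dots> \<le> \<epsilon> * N" using \<open>\<epsilon> > 0\<close> by (intro mult_left_mono) (auto simp: N_def)
    finally have NU: "2 * U \<le> \<epsilon> / 2 * N" by simp
    (* averaging the pullbacks of u by the powers of g, where pulling back adds the cocycle of the power *)
    define p where "p i x = u ((g ^^ i) x) + Birkhoff_sum g (\<l> g) i x" for i x
    define v where "v x = (\<Sum>i<N. p i x) / N" for x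
    have "continuous_on X (p i)" for i
      unfolding p_def Birkhoff_sum_def using cont_\<l>[OF g] u by (intro continuous_intros compose_gi)
    then have "continuous_on X v"
      unfolding v_def using N by (intro continuous_intros) auto
    moreover have "\<bar>\<l> g x + v (g x) - v x\<bar> \<le> \<epsilon>" if "x \<in> X" for x
    proof -
      have shift: "p i (g x) + \<l> g x = p (Suc i) x" for i
        using Birkhoff_sum_add[of g "\<l> g" 1 i x] by (simp add: p_def funpow_swap1)
      have "N * (\<l> g x + v (g x) - v x) = (\<Sum>i<N. p i (g x) + \<l> g x) - (\<Sum>i<N. p i x)"
        using N by (simp add: v_def sum.distrib field_simps)
      also have "\<dots> = (\<Sum>i<N. p (Suc i) x - p i x)"
        by (simp add: shift sum_subtractf)
      also have "\<dots> = p N x - p 0 x"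
        by (rule sum_lessThan_telescope)
      finally have "N * (\<l> g x + v (g x) - v x) = u ((g ^^ N) x) + Birkhoff_sum g (\<l> g) N x - u x"
        by (simp add: p_def)
      then have "\<bar>N * (\<l> g x + v (g x) - v x)\<bar> \<le> N * \<epsilon>"
        using U[OF gX[OF that, of N]] U[OF that] N0[OF N(1) that] NU by (simp add: mult.commute)
      then show ?thesis using N by (simp add: abs_mult)
    qed
    moreover have "\<bar>\<l> f x + v (f x) - v x\<bar> \<le> \<epsilon>" if "f \<in> B" "x \<in> X" for f x
    proof -
      have f: "f \<in> A" using that B by auto
      have cm: "(g ^^ i) (f x) = f ((g ^^ i) x)" for i
        by (induction i) (use comm[OF f g gX[OF that(2)]] in auto)
      have cocN: "Birkhoff_sum g (\<l> g) i (f x) + \<l> f x = \<l> f ((g ^^ i) x) + Birkhoff_sum g (\<l> g) i x" for i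
      proof (induction i)
        case (Suc i)
        then show ?case using coc[OF f g gX[OF that(2), of i]] by (simp add: cm)
      qed simp
      define y where "y i = (g ^^ i) x" for i
      have "p i (f x) + \<l> f x - p i x = \<l> f (y i) + u (f (y i)) - u (y i)" for i
        using cocN[of i] by (simp add: p_def cm y_def)
      then have pt: "\<bar>p i (f x) + \<l> f x - p i x\<bar> \<le> \<epsilon>" for i
        using small[OF that(1) gX[OF that(2), of i]] by (simp add: y_def)
      have "N * (\<l> f x + v (f x) - v x) = (\<Sum>i<N. p i (f x) + \<l> f x - p i x)"
        using N by (simp add: v_def sum.distrib sum_subtractf field_simps)
      then have "\<bar>N * (\<l> f x + v (f x) - v x)\<bar> \<le> (\<Sum>i<N. \<epsilon>)"
        using pt by (simp only:) (rule order_trans[OF sum_abs], intro sum_mono, simp)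
      then show ?thesis using N by (simp add: abs_mult)
    qed
    ultimately show ?case by blast
  qed
  then show ?thesis by blast
qed

section \<open>Derivatives of circle maps through lifts\<close>

lemma cis_Arg_circle: "z \<in> circle \<Longrightarrow> cis (Arg z) = z"
  by (subst cis_Arg) (auto simp: sgn_div_norm)

text \<open>
  The difference of two lifts, divided by \<open>2 * pi\<close>, is continuous and takes only integer values.
\<close>

lemma is_lift_unique:
  assumes F: "is_lift f F" and G: "is_lift f G"
  shows "\<exists>k::int. \<forall>t. G t = F t + 2 * pi * of_int k"
proof -
  define H where "H t = (G t - F t) / (2 * pi)" for t
  have int: "\<exists>k::int. H t = of_int k" for t
  proof -
    have "cis (G t) = cis (F t)" using F G by (simp add: is_lift_def)
    then have "sin (G t) = sin (F t) \<and> cos (G t) = cos (F t)" by (simp add: complex_eq_iff)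
    then obtain k :: int where "G t = F t + 2 * pi * k" unfolding sin_cos_eq_iff by blast
    then show ?thesis by (auto simp: H_def)
  qed
  have "H constant_on UNIV"
  proof (rule continuous_discrete_range_constant)
    show "continuous_on UNIV H"
      using F G unfolding H_def is_lift_def by (auto intro!: continuous_intros)
    show "\<exists>e>0. \<forall>y. y \<in> UNIV \<and> H y \<noteq> H x \<longrightarrow> e \<le> norm (H y - H x)" for x
    proof (intro exI[of _ 1] conjI allI impI)
      fix y assume ne: "y \<in> UNIV \<and> H y \<noteq> H x"
      obtain k l :: int where "H x = of_int k" "H y = of_int l" using int by meson
      then show "1 \<le> norm (H y - H x)" using ne
        by (simp flip: of_int_diff of_int_abs add: abs_if)
    qed simp
  qed simp
  then obtain c where "\<And>t. H t = c" by (auto simp: constant_on_def)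
  then obtain k :: int where "\<And>t. H t = of_int k" using int by metis
  then show ?thesis by (intro exI[of _ k]) (simp add: H_def field_simps)
qed

lemma is_lift_circle_lift: "is_lift f F \<Longrightarrow> is_lift f (circle_lift f)"
  unfolding circle_lift_def by (rule someI[of "is_lift f"])

text \<open>
  The derivatives of a circle map are defined through an arbitrarily chosen lift and the principal
  value of the argument. If the derivative of some lift factors through \<open>cis\<close>, neither choice matters.
\<close>

lemma circle_derivs_eqI:
  assumes lift: "is_lift f F"
    and D: "\<And>t. (F has_real_derivative D (cis t)) (at t)"
    and z: "z \<in> circle"
  shows circle_deriv_eqI: "circle_deriv f z = D z"
    and circle_deriv2_eqI: "(\<And>t. ((\<lambda>t. D (cis t)) has_real_derivative D2 (cis t)) (at t)) \<Longrightarrow>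
           circle_deriv2 f z = D2 z"
proof -
  obtain k :: int where k: "\<And>t. circle_lift f t = F t + 2 * pi * of_int k"
    using is_lift_unique[OF lift is_lift_circle_lift[OF lift]] by blast
  have "(circle_lift f has_real_derivative D (cis t)) (at t)" for t
    unfolding k using D by (auto intro!: derivative_eq_intros)
  then have deriv: "deriv (circle_lift f) = (\<lambda>t. D (cis t))"
    using DERIV_imp_deriv by blast
  have z_cis: "cis (Arg z) = z"
    by (rule cis_Arg_circle[OF z])
  show "circle_deriv f z = D z"
    by (simp add: circle_deriv_def deriv z_cis)
  show "circle_deriv2 f z = D2 z"
    if D2: "\<And>t. ((\<lambda>t. D (cis t)) has_real_derivative D2 (cis t)) (at t)"
    using DERIV_imp_deriv[OF D2[of "Arg z"]] by (simp add: circle_deriv2_def deriv z_cis)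
qed

text \<open>
  Continuity on the circle can thus be checked in the angle coordinate.
\<close>

lemma quotient_map_cis: "quotient_map (top_of_set {0..2 * pi}) (top_of_set circle) cis"
proof (rule continuous_imp_quotient_map)
  show "continuous_map (top_of_set {0..2 * pi}) (top_of_set circle) cis"
    by (auto simp: continuous_map_in_subtopology image_subset_iff intro!: continuous_intros)
  have "z \<in> cis ` {0..2 * pi}" if unit: "cmod z = 1" for z
  proof -
    obtain t where t: "0 \<le> t" "t < 2 * pi" "z = Complex (cos t) (sin t)"
      using complex_unimodular_polar[OF unit] by blast
    from t(3) have "z = cis t" by (simp add: complex_eq_iff)
    with t(1,2) show ?thesis by auto
  qed
  then show "cis ` topspace (top_of_set {0..2 * pi}) = topspace (top_of_set circle)"
    by auto
qed (auto simp: Hausdorff_space_subtopology compact_space_subtopology)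

lemma continuous_map_circleI:
  assumes "continuous_map euclideanreal Y (\<lambda>t. g (cis t))"
  shows "continuous_map (top_of_set circle) Y g"
  using continuous_compose_quotient_map[OF quotient_map_cis, of Y g] assms
  by (simp add: o_def continuous_map_from_subtopology)

lemma continuous_on_circleI:
  fixes g :: "complex \<Rightarrow> 'b::topological_space"
  assumes "continuous_on UNIV (\<lambda>t. g (cis t))"
  shows "continuous_on circle g"
  using continuous_map_circleI[of euclidean g] assms by simp

lemma continuous_on_circle_map:
  assumes "is_lift f F"
  shows "continuous_on circle f"
proof (rule continuous_on_circleI)
  have "continuous_on UNIV (\<lambda>t. cis (F t))"
    using assms unfolding is_lift_def by (intro continuous_on_cis) simp
  then show "continuous_on UNIV (\<lambda>t. f (cis t))" using assms by (simp add: is_lift_def)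
qed

lemma cis_funpow_lift: "is_lift f F \<Longrightarrow> cis ((F ^^ n) t) = (f ^^ n) (cis t)"
  by (induction n) (auto simp: is_lift_def)

lemma continuous_on_funpow:
  fixes F :: "real \<Rightarrow> real"
  shows "continuous_on UNIV F \<Longrightarrow> continuous_on UNIV (F ^^ n)"
proof (induction n)
  case 0 then show ?case by (simp add: id_def)
next
  case (Suc n)
  then show ?case using continuous_on_compose2[of UNIV F UNIV "F ^^ n"] by (simp add: o_def)
qed

lemma circle_group_simps:
  shows circle_group_carrier: "carrier circle_group = Bij circle"
    and circle_group_one_apply: "z \<in> circle \<Longrightarrow> \<one>\<^bsub>circle_group\<^esub> z = z"
    and circle_group_mult_apply:
      "f \<in> Bij circle \<Longrightarrow> g \<in> Bij circle \<Longrightarrow> z \<in> circle \<Longrightarrow> (f \<otimes>\<^bsub>circle_group\<^esub> g) z = f (g z)"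
  by (simp_all add: BijGroup_def compose_def)

lemma circle_group_inv_apply:
  assumes "f \<in> Bij circle" "z \<in> circle"
  shows "(inv\<^bsub>circle_group\<^esub> f) (f z) = z" "f ((inv\<^bsub>circle_group\<^esub> f) z) = z"
proof -
  interpret group circle_group by (rule group_BijGroup)
  have inv: "inv\<^bsub>circle_group\<^esub> f \<in> Bij circle"
    using inv_closed[of f] assms by (simp add: circle_group_carrier)
  show "(inv\<^bsub>circle_group\<^esub> f) (f z) = z"
    using circle_group_mult_apply[OF inv assms] l_inv[of f] assms circle_group_one_apply
    by (simp add: circle_group_carrier)
  show "f ((inv\<^bsub>circle_group\<^esub> f) z) = z"
    using circle_group_mult_apply[OF assms(1) inv assms(2)] r_inv[of f] assms circle_group_one_apply
    by (simp add: circle_group_carrier)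
qed

lemma Bij_circle_apply: "f \<in> Bij circle \<Longrightarrow> z \<in> circle \<Longrightarrow> f z \<in> circle"
  using Bij_imp_funcset by blast

lemma C2_real_derivs:
  assumes "C2_real F"
  shows "(F has_real_derivative deriv F t) (at t)"
    and "(deriv F has_real_derivative deriv (deriv F) t) (at t)"
    and "continuous_on UNIV (deriv F)" "continuous_on UNIV (deriv (deriv F))"
  using assms unfolding C2_real_def
  by (auto simp: differentiable_on_def field_differentiable_derivI real_differentiable_def DERIV_deriv_iff_real_differentiable
      intro!: differentiable_imp_continuous_on)

text \<open>
  Translating a lift by a multiple of \<open>2 * pi\<close> gives another lift, so its derivatives are periodic and
  factor through \<open>cis\<close>. The derivative does not vanish because the inverse map is differentiable too.
\<close>

lemma C2_circle_diffeo:
  assumes f: "f \<in> C2_circle_diffeos"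
  shows C2_circle_diffeo_lift:
      "\<exists>F. is_lift f F \<and> (\<forall>t. (F has_real_derivative circle_deriv f (cis t)) (at t))"
    and C2_circle_diffeo_deriv_pos: "z \<in> circle \<Longrightarrow> circle_deriv f z > 0"
    and C2_circle_diffeo_continuous_deriv: "continuous_on circle (circle_deriv f)"
    and C2_circle_diffeo_continuous_deriv2: "continuous_on circle (circle_deriv2 f)"
proof -
  obtain F where F: "is_lift f F" "C2_real F"
    using f by (auto simp: C2_circle_diffeos_def C2_circle_def)
  obtain K where K: "is_lift (inv\<^bsub>circle_group\<^esub> f) K" "C2_real K"
    using f by (auto simp: C2_circle_diffeos_def C2_circle_def)
  have bij: "f \<in> Bij circle"
    using f by (simp add: C2_circle_diffeos_def circle_group_carrier)
  have shift: "\<exists>c. \<forall>t. F (t + 2 * pi * of_int k) = F t + c" for k :: int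
  proof -
    have "is_lift f (\<lambda>t. F (t + 2 * pi * of_int k))"
      unfolding is_lift_def
    proof (intro conjI allI)
      show "continuous_on UNIV (\<lambda>t. F (t + 2 * pi * of_int k))"
        using F(1) unfolding is_lift_def
        by (auto intro!: continuous_on_compose2[of UNIV F] continuous_intros)
      have "cis (t + 2 * pi * of_int k) = cis t" for t
        by (simp add: cis_mult[symmetric])
      then show "cis (F (t + 2 * pi * of_int k)) = f (cis t)" for t
        using F(1) by (simp add: is_lift_def)
    qed
    then obtain j :: int where "\<And>t. F (t + 2 * pi * of_int k) = F t + 2 * pi * of_int j"
      using is_lift_unique[OF F(1)] by blast
    then show ?thesis by blast
  qed
  define D where "D z = deriv F (Arg z)" for z
  define D2 where "D2 z = deriv (deriv F) (Arg z)" for z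
  have Arg_shift: "\<exists>k::int. t = Arg (cis t) + 2 * pi * of_int k" for t
  proof -
    have "cis (Arg (cis t)) = cis t" by (simp add: cis_Arg_circle)
    then have "sin t = sin (Arg (cis t)) \<and> cos t = cos (Arg (cis t))" by (simp add: complex_eq_iff)
    then show ?thesis unfolding sin_cos_eq_iff by blast
  qed
  have deriv_shift: "deriv G (t + a) = deriv G t"
    if "\<And>t. (G has_real_derivative deriv G t) (at t)" "\<And>t. G (t + a) = G t + c" for G :: "real \<Rightarrow> real" and t a c
  proof -
    have "((\<lambda>t. G (t + a)) has_real_derivative deriv G (t + a)) (at t)"
      using DERIV_shift[of G "deriv G (t + a)" t a] that(1) by blast
    moreover have "((\<lambda>t. G (t + a)) has_real_derivative deriv G t) (at t)"
      unfolding that(2) using that(1) by (auto intro!: derivative_eq_intros)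
    ultimately show ?thesis by (rule DERIV_unique)
  qed
  have per1: "deriv F (t + 2 * pi * of_int k) = deriv F t" for t and k :: int
  proof -
    obtain c where c: "\<And>t. F (t + 2 * pi * of_int k) = F t + c" using shift by blast
    show ?thesis by (rule deriv_shift[OF C2_real_derivs(1)[OF F(2)] c])
  qed
  have per2: "deriv (deriv F) (t + 2 * pi * of_int k) = deriv (deriv F) t" for t and k :: int
    by (rule deriv_shift[OF C2_real_derivs(2)[OF F(2)], of _ 0]) (simp add: per1)
  have D: "D (cis t) = deriv F t" for t
    unfolding D_def using Arg_shift[of t] per1 by metis
  have D2: "D2 (cis t) = deriv (deriv F) t" for t
    unfolding D2_def using Arg_shift[of t] per2 by metis
  have F': "(F has_real_derivative D (cis t)) (at t)" for t
    unfolding D by (rule C2_real_derivs[OF F(2)])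
  have F'': "((\<lambda>t. D (cis t)) has_real_derivative D2 (cis t)) (at t)" for t
    unfolding D D2 by (rule C2_real_derivs[OF F(2)])
  have eq: "circle_deriv f z = D z" "circle_deriv2 f z = D2 z" if "z \<in> circle" for z
    by (rule circle_deriv_eqI[OF F(1) F' that], rule circle_deriv2_eqI[OF F(1) F' that F''])
  have "D (cis t) > 0" for t
  proof -
    obtain S where S: "is_lift f S" "strict_mono S"
      using f by (auto simp: C2_circle_diffeos_def orientation_preserving_def)
    obtain k :: int where "\<And>t. F t = S t + 2 * pi * of_int k"
      using is_lift_unique[OF S(1) F(1)] by blast
    then have "mono F" using strict_mono_mono[OF S(2)] by (simp add: mono_def)
    then have "D (cis t) \<ge> 0"
      using mono_on_imp_deriv_nonneg[of UNIV F, OF _ F'] by (simp add: mono_on_def mono_def)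
    (* the lift K of the inverse gives K (F t) = t + 2 * pi * k, which has derivative 1 *)
    moreover have "D (cis t) \<noteq> 0"
    proof
      assume 0: "D (cis t) = 0"
      have "is_lift (\<lambda>z. z) (\<lambda>t. K (F t))"
        using F(1) K(1) circle_group_inv_apply(1)[OF bij] unfolding is_lift_def
        by (auto intro!: continuous_on_compose2[of UNIV K])
      moreover have "is_lift (\<lambda>z. z) (\<lambda>t. t)" by (simp add: is_lift_def)
      ultimately obtain k :: int where k: "\<And>t. K (F t) = t + 2 * pi * of_int k"
        using is_lift_unique by blast
      have "((\<lambda>t. K (F t)) has_real_derivative deriv K (F t) * D (cis t)) (at t)"
        by (rule DERIV_chain2[OF C2_real_derivs(1)[OF K(2)] F'])
      moreover have "((\<lambda>t. K (F t)) has_real_derivative 1) (at t)"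
        unfolding k by (auto intro!: derivative_eq_intros)
      ultimately show False using 0 DERIV_unique by fastforce
    qed
    ultimately show ?thesis by simp
  qed
  then have "circle_deriv f (cis t) > 0" for t by (simp add: eq)
  from this[of "Arg z"] show "circle_deriv f z > 0" if "z \<in> circle"
    by (simp only: cis_Arg_circle[OF that])
  have "continuous_on circle D"
    by (rule continuous_on_circleI) (simp add: D C2_real_derivs(3)[OF F(2)])
  then show "continuous_on circle (circle_deriv f)"
    by (rule continuous_on_eq) (simp add: eq)
  have "continuous_on circle D2"
    by (rule continuous_on_circleI) (simp add: D2 C2_real_derivs(4)[OF F(2)])
  then show "continuous_on circle (circle_deriv2 f)"
    by (rule continuous_on_eq) (simp add: eq)
  have "(F has_real_derivative circle_deriv f (cis t)) (at t)" for t
    using F'[of t] by (simp add: eq)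
  with F(1) show "\<exists>F. is_lift f F \<and> (\<forall>t. (F has_real_derivative circle_deriv f (cis t)) (at t))"
    by blast
qed

lemma circle_deriv_mult:
  assumes f: "f \<in> C2_circle_diffeos" and g: "g \<in> C2_circle_diffeos" and z: "z \<in> circle"
  shows "circle_deriv (f \<otimes>\<^bsub>circle_group\<^esub> g) z = circle_deriv f (g z) * circle_deriv g z"
proof -
  obtain F where F: "is_lift f F" "\<And>t. (F has_real_derivative circle_deriv f (cis t)) (at t)"
    using C2_circle_diffeo_lift[OF f] by blast
  obtain G where G: "is_lift g G" "\<And>t. (G has_real_derivative circle_deriv g (cis t)) (at t)"
    using C2_circle_diffeo_lift[OF g] by blast
  have bij: "f \<in> Bij circle" "g \<in> Bij circle"
    using f g by (simp_all add: C2_circle_diffeos_def circle_group_carrier)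
  show ?thesis
  proof (rule circle_deriv_eqI[OF _ _ z])
    show "is_lift (f \<otimes>\<^bsub>circle_group\<^esub> g) (\<lambda>t. F (G t))"
      using F(1) G(1) unfolding is_lift_def
      by (auto intro!: continuous_on_compose2[of UNIV F] simp: circle_group_mult_apply[OF bij])
    show "((\<lambda>t. F (G t)) has_real_derivative circle_deriv f (g (cis t)) * circle_deriv g (cis t)) (at t)" for t
      using DERIV_chain2[OF F(2) G(2), of t] G(1) by (simp add: is_lift_def)
  qed
qed

lemma C2_circle_diffeo_Bij: "f \<in> C2_circle_diffeos \<Longrightarrow> f \<in> Bij circle"
  by (simp add: C2_circle_diffeos_def circle_group_carrier)

definition log_deriv :: "(complex \<Rightarrow> complex) \<Rightarrow> complex \<Rightarrow> real" where
  "log_deriv f z = ln (circle_deriv f z)"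

lemma continuous_on_log_deriv:
  assumes "f \<in> C2_circle_diffeos"
  shows "continuous_on circle (log_deriv f)"
proof -
  have "circle_deriv f z \<noteq> 0" if "z \<in> circle" for z
    using C2_circle_diffeo_deriv_pos[OF assms that] by simp
  then show ?thesis
    unfolding log_deriv_def[abs_def]
    using C2_circle_diffeo_continuous_deriv[OF assms] by (intro continuous_on_ln) auto
qed

lemma exp_log_deriv: "f \<in> C2_circle_diffeos \<Longrightarrow> z \<in> circle \<Longrightarrow> exp (log_deriv f z) = circle_deriv f z"
  by (simp add: log_deriv_def C2_circle_diffeo_deriv_pos)

lemma log_deriv_mult:
  assumes "f \<in> C2_circle_diffeos" "g \<in> C2_circle_diffeos" "z \<in> circle"
  shows "log_deriv (f \<otimes>\<^bsub>circle_group\<^esub> g) z = log_deriv f (g z) + log_deriv g z"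
  using C2_circle_diffeo_deriv_pos[OF assms(1) Bij_circle_apply[OF C2_circle_diffeo_Bij[OF assms(2)] assms(3)]]
    C2_circle_diffeo_deriv_pos[OF assms(2,3)]
  by (simp add: log_deriv_def circle_deriv_mult[OF assms] ln_mult)

lemma log_deriv_one:
  assumes "z \<in> circle"
  shows "log_deriv \<one>\<^bsub>circle_group\<^esub> z = 0"
proof -
  have "circle_deriv \<one>\<^bsub>circle_group\<^esub> z = 1"
    using assms by (intro circle_deriv_eqI[where F = "\<lambda>t. t" and D = "\<lambda>_. 1"])
      (auto simp: is_lift_def circle_group_one_apply)
  then show ?thesis by (simp add: log_deriv_def)
qed

section \<open>Moebius transformations and their 2-jets\<close>

text \<open>
  These are the transformations of the circle given by \<open>SU(1,1)\<close>, the conjugate of \<open>SL(2,R)\<close> by the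
  Cayley transform. In contrast to the parameters \<open>\<kappa>\<close> and \<open>\<sigma>\<close>, the coefficients compose by multiplication
  of matrices.
\<close>

definition disc_aut :: "complex \<Rightarrow> complex \<Rightarrow> complex \<Rightarrow> complex" where
  "disc_aut \<alpha> \<beta> = restrict (\<lambda>z. (\<alpha> * z + \<beta>) / (cnj \<beta> * z + cnj \<alpha>)) circle"

abbreviation SU11 :: "complex \<Rightarrow> complex \<Rightarrow> bool" where
  "SU11 \<alpha> \<beta> \<equiv> (cmod \<alpha>)\<^sup>2 - (cmod \<beta>)\<^sup>2 = 1"

lemma SU11_denominator_nonzero:
  assumes "SU11 \<alpha> \<beta>" "z \<in> circle"
  shows "cnj \<beta> * z + cnj \<alpha> \<noteq> 0"
proof
  assume "cnj \<beta> * z + cnj \<alpha> = 0"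
  then have "cmod (cnj \<alpha>) = cmod (cnj \<beta> * z)"
    by (metis add.commute eq_neg_iff_add_eq_0 norm_minus_cancel)
  then show False using assms by (simp add: norm_mult)
qed

lemma SU11_norm_less:
  assumes "SU11 \<alpha> \<beta>"
  shows "cmod \<beta> < cmod \<alpha>"
proof (rule power2_less_imp_less)
  show "(cmod \<beta>)\<^sup>2 < (cmod \<alpha>)\<^sup>2" using assms by linarith
qed simp

lemma SU11_nonzero:
  assumes "SU11 \<alpha> \<beta>"
  shows "\<alpha> \<noteq> 0"
  using SU11_norm_less[OF assms] by auto

lemma circle_cnj: "z \<in> circle \<Longrightarrow> z * cnj z = 1"
  by (simp add: complex_norm_square[symmetric])

text \<open>
  On the circle the numerator is \<open>z\<close> times the conjugate of the denominator, so the denominator alone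
  determines the value, and by \<open>disc_aut_jet\<close> also the derivative.
\<close>

lemma disc_aut_apply:
  assumes "z \<in> circle"
  shows "disc_aut \<alpha> \<beta> z = z * cnj (cnj \<beta> * z + cnj \<alpha>) / (cnj \<beta> * z + cnj \<alpha>)"
proof -
  have "z * cnj (cnj \<beta> * z + cnj \<alpha>) = \<alpha> * z + \<beta> * (z * cnj z)"
    by (simp add: algebra_simps)
  then show ?thesis using assms circle_cnj[OF assms] by (simp add: disc_aut_def)
qed

lemma disc_aut_in_circle:
  assumes "SU11 \<alpha> \<beta>" "z \<in> circle"
  shows "disc_aut \<alpha> \<beta> z \<in> circle"
  using SU11_denominator_nonzero[OF assms] assms(2)
  by (simp add: disc_aut_apply norm_mult norm_divide del: complex_cnj_add complex_cnj_mult)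

lemma disc_aut_disc_aut:
  assumes "SU11 \<gamma> \<delta>" "z \<in> circle"
  shows "disc_aut \<alpha> \<beta> (disc_aut \<gamma> \<delta> z) =
    disc_aut (\<alpha> * \<gamma> + \<beta> * cnj \<delta>) (\<alpha> * \<delta> + \<beta> * cnj \<gamma>) z"
proof -
  define y where "y = cnj \<delta> * z + cnj \<gamma>"
  have y: "y \<noteq> 0" unfolding y_def by (rule SU11_denominator_nonzero[OF assms])
  have w: "disc_aut \<gamma> \<delta> z = (\<gamma> * z + \<delta>) / y" "disc_aut \<gamma> \<delta> z \<in> circle"
    using assms disc_aut_in_circle[OF assms] by (simp_all add: disc_aut_def y_def)
  have "disc_aut \<alpha> \<beta> (disc_aut \<gamma> \<delta> z) =
      (\<alpha> * ((\<gamma> * z + \<delta>) / y) + \<beta>) * y / ((cnj \<beta> * ((\<gamma> * z + \<delta>) / y) + cnj \<alpha>) * y)"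
    using w y unfolding disc_aut_def[of \<alpha> \<beta>] by simp
  also have "(\<alpha> * ((\<gamma> * z + \<delta>) / y) + \<beta>) * y = \<alpha> * (\<gamma> * z + \<delta>) + \<beta> * y"
    using y by (simp add: distrib_right)
  also have "(cnj \<beta> * ((\<gamma> * z + \<delta>) / y) + cnj \<alpha>) * y = cnj \<beta> * (\<gamma> * z + \<delta>) + cnj \<alpha> * y"
    using y by (simp add: distrib_right)
  also have "(\<alpha> * (\<gamma> * z + \<delta>) + \<beta> * y) / (cnj \<beta> * (\<gamma> * z + \<delta>) + cnj \<alpha> * y) =
      disc_aut (\<alpha> * \<gamma> + \<beta> * cnj \<delta>) (\<alpha> * \<delta> + \<beta> * cnj \<gamma>) z"
    using assms(2) unfolding disc_aut_def y_def by (simp add: algebra_simps)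
  finally show ?thesis .
qed

lemma disc_aut_one: "disc_aut 1 0 = \<one>\<^bsub>circle_group\<^esub>"
  by (simp add: disc_aut_def BijGroup_def)

lemma disc_aut_Bij:
  assumes "SU11 \<alpha> \<beta>"
  shows "disc_aut \<alpha> \<beta> \<in> Bij circle"
proof -
  have SU': "SU11 (cnj \<alpha>) (- \<beta>)" using assms by simp
  have norm: "\<alpha> * cnj \<alpha> - \<beta> * cnj \<beta> = 1"
    using assms by (metis complex_norm_square of_real_1 of_real_diff)
  have 1: "disc_aut (cnj \<alpha>) (- \<beta>) (disc_aut \<alpha> \<beta> z) = z" if "z \<in> circle" for z
    using that norm by (subst disc_aut_disc_aut[OF assms that]) (simp add: disc_aut_def mult.commute)
  have 2: "disc_aut \<alpha> \<beta> (disc_aut (cnj \<alpha>) (- \<beta>) z) = z" if "z \<in> circle" for z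
    using that norm by (subst disc_aut_disc_aut[OF SU' that]) (simp add: disc_aut_def mult.commute)
  have "bij_betw (disc_aut \<alpha> \<beta>) circle circle"
    by (rule bij_betw_byWitness[where f' = "disc_aut (cnj \<alpha>) (- \<beta>)"])
      (use 1 2 disc_aut_in_circle[OF assms] disc_aut_in_circle[OF SU'] in auto)
  then show ?thesis by (simp add: Bij_def disc_aut_def)
qed

lemma disc_aut_mult:
  assumes "SU11 \<alpha> \<beta>" "SU11 \<gamma> \<delta>"
  shows "disc_aut \<alpha> \<beta> \<otimes>\<^bsub>circle_group\<^esub> disc_aut \<gamma> \<delta> =
    disc_aut (\<alpha> * \<gamma> + \<beta> * cnj \<delta>) (\<alpha> * \<delta> + \<beta> * cnj \<gamma>)"
proof -
  have "disc_aut \<alpha> \<beta> \<otimes>\<^bsub>circle_group\<^esub> disc_aut \<gamma> \<delta> = compose circle (disc_aut \<alpha> \<beta>) (disc_aut \<gamma> \<delta>)"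
    using disc_aut_Bij assms by (simp add: BijGroup_def)
  also have "\<dots> = disc_aut (\<alpha> * \<gamma> + \<beta> * cnj \<delta>) (\<alpha> * \<delta> + \<beta> * cnj \<gamma>)"
  proof
    fix z
    show "compose circle (disc_aut \<alpha> \<beta>) (disc_aut \<gamma> \<delta>) z =
        disc_aut (\<alpha> * \<gamma> + \<beta> * cnj \<delta>) (\<alpha> * \<delta> + \<beta> * cnj \<gamma>) z"
    proof (cases "z \<in> circle")
      case True
      then show ?thesis using disc_aut_disc_aut[OF assms(2) True] by (simp add: compose_def)
    next
      case False
      then show ?thesis by (simp add: compose_def disc_aut_def)
    qed
  qed
  finally show ?thesis .
qed

lemma disc_aut_uminus: "disc_aut (- \<alpha>) (- \<beta>) = disc_aut \<alpha> \<beta>"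
proof -
  have "(- \<alpha> * z + - \<beta>) / (cnj (- \<beta>) * z + cnj (- \<alpha>)) = (\<alpha> * z + \<beta>) / (cnj \<beta> * z + cnj \<alpha>)" for z
  proof -
    have "- \<alpha> * z + - \<beta> = - (\<alpha> * z + \<beta>)" "cnj (- \<beta>) * z + cnj (- \<alpha>) = - (cnj \<beta> * z + cnj \<alpha>)"
      by simp_all
    then show ?thesis by (simp only: minus_divide_divide)
  qed
  then show ?thesis unfolding disc_aut_def by (simp only:)
qed

text \<open>
  The right inverse of the passage from real matrices to coefficients in \<open>SL2R_map\<close>.
\<close>

definition SU11_matrix :: "complex \<Rightarrow> complex \<Rightarrow> real^2^2" where
  "SU11_matrix \<alpha> \<beta> =
     vector [vector [Re \<alpha> + Re \<beta>, Im \<alpha> - Im \<beta>], vector [- Im \<alpha> - Im \<beta>, Re \<alpha> - Re \<beta>]]"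

lemma SL2R_map_SU11_matrix: "SL2R_map (SU11_matrix \<alpha> \<beta>) = disc_aut \<alpha> \<beta>"
proof -
  have "Complex ((SU11_matrix \<alpha> \<beta>$1$1 + SU11_matrix \<alpha> \<beta>$2$2) / 2)
          ((SU11_matrix \<alpha> \<beta>$1$2 - SU11_matrix \<alpha> \<beta>$2$1) / 2) = \<alpha>"
    "Complex ((SU11_matrix \<alpha> \<beta>$1$1 - SU11_matrix \<alpha> \<beta>$2$2) / 2)
          (- (SU11_matrix \<alpha> \<beta>$1$2 + SU11_matrix \<alpha> \<beta>$2$1) / 2) = \<beta>"
    by (simp_all add: SU11_matrix_def complex_eq_iff)
  then show ?thesis unfolding SL2R_map_def disc_aut_def Let_def by (simp only:)
qed

lemma SU11_matrix_in_SL2R: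
  assumes "SU11 \<alpha> \<beta>"
  shows "SU11_matrix \<alpha> \<beta> \<in> SL2R"
proof -
  have "det (SU11_matrix \<alpha> \<beta>) = (cmod \<alpha>)\<^sup>2 - (cmod \<beta>)\<^sup>2"
    unfolding cmod_power2 by (simp add: SU11_matrix_def det_2 power2_eq_square algebra_simps)
  then show ?thesis using assms by (simp add: SL2R_def)
qed

lemma Moebius_iff_disc_aut: "P \<in> Moebius \<longleftrightarrow> (\<exists>\<alpha> \<beta>. SU11 \<alpha> \<beta> \<and> P = disc_aut \<alpha> \<beta>)"
proof
  assume "P \<in> Moebius"
  then obtain A where A: "A \<in> SL2R" "P = SL2R_map A" using SL2R_map_image by blast
  obtain \<alpha> \<beta> where
    "SL2R_map A = restrict (\<lambda>z. (\<alpha> * z + \<beta>) / (cnj \<beta> * z + cnj \<alpha>)) circle" "SU11 \<alpha> \<beta>"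
    by (rule SL2R_coefficients[OF A(1)])
  then show "\<exists>\<alpha> \<beta>. SU11 \<alpha> \<beta> \<and> P = disc_aut \<alpha> \<beta>"
    using A(2) by (auto simp: disc_aut_def)
next
  assume "\<exists>\<alpha> \<beta>. SU11 \<alpha> \<beta> \<and> P = disc_aut \<alpha> \<beta>"
  then show "P \<in> Moebius"
    using SL2R_map_in_Moebius SU11_matrix_in_SL2R SL2R_map_SU11_matrix by metis
qed

lemma continuous_map_disc_aut:
  fixes \<alpha> \<beta> :: "'a::topological_space \<Rightarrow> complex"
  assumes "continuous_on X \<alpha>" "continuous_on X \<beta>" and "\<And>x. x \<in> X \<Longrightarrow> SU11 (\<alpha> x) (\<beta> x)"
  shows "continuous_map (top_of_set X) Moebius_topology (\<lambda>x. disc_aut (\<alpha> x) (\<beta> x))"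
proof -
  have "continuous_on X (\<lambda>x. SU11_matrix (\<alpha> x) (\<beta> x) $ i $ j)" for i j
    using exhaust_2[of i] exhaust_2[of j] assms(1,2)
    by (elim disjE) (simp_all add: SU11_matrix_def continuous_on_add continuous_on_diff
        continuous_on_minus continuous_on_Re continuous_on_Im)
  then have "continuous_on X (\<lambda>x. SU11_matrix (\<alpha> x) (\<beta> x))"
    unfolding continuous_on_def by (blast intro: vec_tendstoI)
  then have "continuous_map (top_of_set X) (top_of_set SL2R) (\<lambda>x. SU11_matrix (\<alpha> x) (\<beta> x))"
    using SU11_matrix_in_SL2R assms(3) by (auto simp: continuous_map_in_subtopology)
  from continuous_map_compose[OF this quotient_imp_continuous_map[OF quotient_map_SL2R_map]]
  show ?thesis by (simp add: o_def SL2R_map_SU11_matrix)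
qed

lemma cis_double_Arg:
  assumes "w \<noteq> 0"
  shows "cis (2 * Arg w) = w / cnj w"
proof -
  have "cis (2 * Arg w) = sgn w * sgn w"
    using cis_mult[of "Arg w" "Arg w"] cis_Arg[OF assms] by simp
  also have "\<dots> = w / cnj w"
    using assms complex_norm_square[of w]
    by (simp add: sgn_eq field_simps power2_eq_square)
  finally show ?thesis .
qed

text \<open>
  The map is \<open>z * w / cnj w\<close> with \<open>w = \<alpha> * (1 + \<zeta>)\<close> and \<open>\<bar>\<zeta>\<bar> < 1\<close>, so that twice the principal argument
  of \<open>1 + \<zeta>\<close> gives a smooth lift. Its derivative is the reciprocal of \<open>\<bar>y\<bar>\<^sup>2\<close>, a trigonometric polynomial
  of degree one in the angle, from which the second derivative is read off.
\<close>

lemma disc_aut_jet: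
  assumes SU: "SU11 \<alpha> \<beta>" and z: "z \<in> circle"
  defines "y \<equiv> \<lambda>z. cnj \<beta> * z + cnj \<alpha>"
  shows "circle_deriv (disc_aut \<alpha> \<beta>) z = 1 / (cmod (y z))\<^sup>2"
    and "circle_deriv2 (disc_aut \<alpha> \<beta>) z = - 2 * Im (cnj \<alpha> * cnj (y z)) / (cmod (y z)) ^ 4"
proof -
  have nz: "\<alpha> \<noteq> 0" by (rule SU11_nonzero[OF SU])
  define \<zeta> where "\<zeta> t = \<beta> / \<alpha> * cis (- t)" for t
  have \<zeta>_lt: "cmod (\<zeta> t) < 1" for t
    using SU11_norm_less[OF SU] nz by (simp add: \<zeta>_def norm_mult norm_divide)
  have Re_pos: "Re (1 + \<zeta> t) > 0" for t
    using \<zeta>_lt[of t] abs_Re_le_cmod[of "\<zeta> t"] by simp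
  have nz\<zeta>: "1 + \<zeta> t \<noteq> 0" for t using Re_pos[of t] by (metis less_irrefl zero_complex.simps(1))
  have y\<zeta>: "y (cis t) = cnj (\<alpha> * (1 + \<zeta> t))" for t
    using nz by (simp add: y_def \<zeta>_def cis_cnj algebra_simps)
  define \<Phi> where "\<Phi> t = t + 2 * Arg \<alpha> + 2 * Im (Ln (1 + \<zeta> t))" for t
  have lift: "is_lift (disc_aut \<alpha> \<beta>) \<Phi>"
    unfolding is_lift_def
  proof (intro conjI allI)
    show "continuous_on UNIV \<Phi>"
      unfolding \<Phi>_def \<zeta>_def[abs_def]
      using Re_pos[unfolded \<zeta>_def] nz
      by (intro continuous_intros) (auto simp: complex_nonpos_Reals_iff not_le)
    fix t
    have "cis (\<Phi> t) = cis t * cis (2 * Arg \<alpha>) * cis (2 * Arg (1 + \<zeta> t))"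
      using nz\<zeta>[of t] by (simp add: \<Phi>_def cis_mult Arg_eq_Im_Ln)
    also have "\<dots> = cis t * cnj (y (cis t)) / y (cis t)"
      using nz nz\<zeta>[of t] by (simp add: cis_double_Arg y\<zeta>)
    finally show "cis (\<Phi> t) = disc_aut \<alpha> \<beta> (cis t)"
      by (simp add: disc_aut_apply y_def)
  qed
  define D where "D z = 1 / (cmod (y z))\<^sup>2" for z
  define D2 where "D2 z = - 2 * Im (cnj \<alpha> * cnj (y z)) / (cmod (y z)) ^ 4" for z
  have D: "(\<Phi> has_real_derivative D (cis t)) (at t)" for t
  proof -
    have "((\<lambda>s. cis (- s)) has_derivative (\<lambda>h. (- h) *\<^sub>R (\<i> * cis (- t)))) (at t)"
      by (rule has_derivative_cis) (rule has_derivative_minus, rule has_derivative_ident)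
    then have "((\<lambda>s. cis (- s)) has_vector_derivative - \<i> * cis (- t)) (at t)"
      by (simp add: has_vector_derivative_def)
    from has_vector_derivative_mult_right[OF this, of "\<beta> / \<alpha>"]
    have "(\<zeta> has_vector_derivative - \<i> * \<zeta> t) (at t)"
      unfolding \<zeta>_def[abs_def] by (simp add: mult.left_commute)
    then have curve: "((\<lambda>t. 1 + \<zeta> t) has_vector_derivative - \<i> * \<zeta> t) (at t)"
      by (auto intro!: derivative_eq_intros)
    have Ln: "(Ln has_field_derivative inverse (1 + \<zeta> t)) (at (1 + \<zeta> t))"
      using Re_pos[of t] by (intro has_field_derivative_Ln) (auto simp: complex_nonpos_Reals_iff)
    from field_vector_diff_chain_at[OF curve Ln]
    have "((\<lambda>t. Ln (1 + \<zeta> t)) has_vector_derivative (- \<i> * \<zeta> t) * inverse (1 + \<zeta> t)) (at t)"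
      by (simp only: o_def)
    from bounded_linear.has_vector_derivative[OF bounded_linear_Im this]
    have "((\<lambda>t. Im (Ln (1 + \<zeta> t))) has_real_derivative Im ((- \<i> * \<zeta> t) * inverse (1 + \<zeta> t))) (at t)"
      by (simp add: has_real_derivative_iff_has_vector_derivative)
    from DERIV_add[OF DERIV_add[OF DERIV_ident DERIV_const[of "2 * Arg \<alpha>"]] DERIV_cmult[OF this, of 2]]
    have "(\<Phi> has_real_derivative 1 + 2 * Im ((- \<i> * \<zeta> t) * inverse (1 + \<zeta> t))) (at t)"
      unfolding \<Phi>_def[abs_def] by (simp only: add_0_right)
    moreover have "1 + 2 * Im ((- \<i> * \<zeta> t) * inverse (1 + \<zeta> t)) = D (cis t)"
    proof -
      have E: "(cmod (y (cis t)))\<^sup>2 = (cmod \<alpha>)\<^sup>2 * (cmod (1 + \<zeta> t))\<^sup>2"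
        by (simp only: y\<zeta> complex_mod_cnj norm_mult power_mult_distrib)
      define X where "X = 1 + 2 * Im ((- \<i> * \<zeta> t) * inverse (1 + \<zeta> t))"
      have "(cmod \<alpha>)\<^sup>2 * (1 - (cmod (\<zeta> t))\<^sup>2) = (cmod \<alpha>)\<^sup>2 - (cmod \<beta>)\<^sup>2"
        using nz by (simp add: \<zeta>_def norm_mult norm_divide power_divide right_diff_distrib)
      with SU have unit: "(cmod \<alpha>)\<^sup>2 * (1 - (cmod (\<zeta> t))\<^sup>2) = 1" by simp
      have X: "X * (cmod (1 + \<zeta> t))\<^sup>2 = 1 - (cmod (\<zeta> t))\<^sup>2"
      proof -
        have "Im ((- \<i> * \<zeta> t) * inverse (1 + \<zeta> t)) = - Re (\<zeta> t / (1 + \<zeta> t))"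
          by (simp add: divide_inverse)
        moreover have "Re (\<zeta> t / (1 + \<zeta> t)) * (cmod (1 + \<zeta> t))\<^sup>2 =
            Re (\<zeta> t) * Re (1 + \<zeta> t) + Im (\<zeta> t) * Im (1 + \<zeta> t)"
          using nz\<zeta>[of t] by (simp only: Re_divide cmod_power2[symmetric]) simp
        ultimately have "X * (cmod (1 + \<zeta> t))\<^sup>2 =
            (cmod (1 + \<zeta> t))\<^sup>2 - 2 * (Re (\<zeta> t) * Re (1 + \<zeta> t) + Im (\<zeta> t) * Im (1 + \<zeta> t))"
          unfolding X_def by (simp only: distrib_right) simp
        also have "\<dots> = 1 - (cmod (\<zeta> t))\<^sup>2"
          unfolding cmod_power2 by (simp add: power2_eq_square algebra_simps)
        finally show ?thesis .
      qed
      have "X * (cmod (y (cis t)))\<^sup>2 = (cmod \<alpha>)\<^sup>2 * (X * (cmod (1 + \<zeta> t))\<^sup>2)"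
        by (simp only: E mult.left_commute)
      also have "\<dots> = 1" by (simp only: X unit)
      finally have "X * (cmod (y (cis t)))\<^sup>2 = 1" .
      then have "X = D (cis t)"
        unfolding D_def by (auto simp: eq_divide_eq)
      then show ?thesis by (simp only: X_def)
    qed
    ultimately show ?thesis by simp
  qed
  have ynz: "y (cis t) \<noteq> 0" for t
    unfolding y_def by (rule SU11_denominator_nonzero[OF SU]) simp
  have D2: "((\<lambda>t. D (cis t)) has_real_derivative D2 (cis t)) (at t)" for t
  proof -
    define E where "E s = (cmod \<alpha>)\<^sup>2 + (cmod \<beta>)\<^sup>2 + 2 * (Re (cnj \<alpha> * \<beta>) * cos s + Im (cnj \<alpha> * \<beta>) * sin s)" for s
    have E: "(cmod (y (cis s)))\<^sup>2 = E s" for s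
    proof -
      have "(cmod (y (cis s)))\<^sup>2 = (Re (y (cis s)))\<^sup>2 + (Im (y (cis s)))\<^sup>2" by (rule cmod_power2)
      also have "\<dots> = (cmod \<alpha>)\<^sup>2 + (cmod \<beta>)\<^sup>2 * ((sin s)\<^sup>2 + (cos s)\<^sup>2) + 2 * (Re (cnj \<alpha> * \<beta>) * cos s + Im (cnj \<alpha> * \<beta>) * sin s)"
        unfolding cmod_power2
        by (simp add: y_def power2_eq_square algebra_simps
            del: sin_cos_squared_add sin_cos_squared_add2 sin_cos_squared_add3)
      finally show ?thesis by (simp add: E_def)
    qed
    have E': "(E has_real_derivative 2 * Im (cnj \<alpha> * cnj (y (cis t)))) (at t)"
      unfolding E_def y_def by (auto intro!: derivative_eq_intros simp: algebra_simps)
    have "E t \<noteq> 0" using ynz[of t] E[of t] by auto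
    have "((\<lambda>s. 1 / E s) has_real_derivative - (2 * Im (cnj \<alpha> * cnj (y (cis t)))) / (E t)\<^sup>2) (at t)"
      using E' \<open>E t \<noteq> 0\<close> by (auto intro!: derivative_eq_intros simp: power2_eq_square)
    moreover have "(E t)\<^sup>2 = (cmod (y (cis t))) ^ 4" by (simp flip: E)
    ultimately show ?thesis by (simp add: D_def D2_def E)
  qed
  show "circle_deriv (disc_aut \<alpha> \<beta>) z = 1 / (cmod (y z))\<^sup>2"
    using circle_deriv_eqI[OF lift D z] by (simp add: D_def)
  show "circle_deriv2 (disc_aut \<alpha> \<beta>) z = - 2 * Im (cnj \<alpha> * cnj (y z)) / (cmod (y z)) ^ 4"
    using circle_deriv2_eqI[OF lift D z D2] by (simp add: D2_def)
qed

text \<open>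
  The value and the first derivative determine the square of the denominator \<open>y\<close>, hence \<open>y\<close> up to
  sign. The second derivative then gives the imaginary part of \<open>cnj \<alpha> * cnj y\<close>, whose real
  part is \<open>(\<bar>y\<bar>\<^sup>2 + 1) / 2\<close> because the determinant is \<open>1\<close>. So \<open>\<alpha>\<close> and \<open>\<beta>\<close> are determined up to the same sign.
\<close>

lemma disc_aut_eqI_jet:
  assumes SU: "SU11 \<alpha> \<beta>" "SU11 \<gamma> \<delta>" and z: "z \<in> circle"
    and val: "disc_aut \<alpha> \<beta> z = disc_aut \<gamma> \<delta> z"
    and der: "circle_deriv (disc_aut \<alpha> \<beta>) z = circle_deriv (disc_aut \<gamma> \<delta>) z"
    and der2: "circle_deriv2 (disc_aut \<alpha> \<beta>) z = circle_deriv2 (disc_aut \<gamma> \<delta>) z"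
  shows "disc_aut \<alpha> \<beta> = disc_aut \<gamma> \<delta>"
proof -
  define x y where "x = cnj \<beta> * z + cnj \<alpha>" and "y = cnj \<delta> * z + cnj \<gamma>"
  have nz: "x \<noteq> 0" "y \<noteq> 0"
    unfolding x_def y_def using SU11_denominator_nonzero[OF _ z] SU by blast+
  have norm: "(cmod x)\<^sup>2 = (cmod y)\<^sup>2"
    using der nz unfolding disc_aut_jet(1)[OF SU(1) z] disc_aut_jet(1)[OF SU(2) z]
    by (simp add: x_def[symmetric] y_def[symmetric])
  then have norm': "cmod x = cmod y" by (simp add: power2_eq_iff_nonneg)
  have "z * cnj x / x = z * cnj y / y"
    using val unfolding disc_aut_apply[OF z] by (simp only: x_def y_def)
  moreover have "z \<noteq> 0" using z by auto
  ultimately have quot: "cnj x * y = cnj y * x" using nz by (simp add: frac_eq_eq)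
  (* equal squares: x and y have the same modulus and, by quot, parallel directions *)
  have "y * y = (y * cnj y) * (x * y) / (cnj y * x)"
    using nz by simp
  also have "\<dots> = (y * cnj y) * (x * y) / (cnj x * y)" by (simp only: quot)
  also have "y * cnj y = x * cnj x" using norm by (simp only: complex_norm_square[symmetric])
  also have "(x * cnj x) * (x * y) / (cnj x * y) = x * x" using nz by simp
  finally have "y * y = x * x" .
  then have sign: "y = x \<or> y = - x" by (simp add: square_eq_iff)
  (* expand the square of the modulus of beta, which is that of w - cnj alpha *)
  have Re: "2 * Re (cnj \<alpha> * cnj (cnj \<beta> * z + cnj \<alpha>)) = (cmod (cnj \<beta> * z + cnj \<alpha>))\<^sup>2 + 1"
    if "SU11 \<alpha> \<beta>" for \<alpha> \<beta>
  proof -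
    define w where "w = cnj \<beta> * z + cnj \<alpha>"
    have "(cmod \<beta>)\<^sup>2 = (cmod (w - cnj \<alpha>))\<^sup>2"
      using z by (simp add: w_def norm_mult)
    also have "\<dots> = (cmod w)\<^sup>2 + (cmod \<alpha>)\<^sup>2 - 2 * Re (cnj \<alpha> * cnj w)"
      unfolding cmod_power2 by (simp add: power2_eq_square algebra_simps)
    finally show ?thesis using that by (simp add: w_def)
  qed
  have "Re (cnj \<alpha> * cnj x) = Re (cnj \<gamma> * cnj y)"
    using Re[OF SU(1)] Re[OF SU(2)] norm unfolding x_def[symmetric] y_def[symmetric] by linarith
  moreover have "Im (cnj \<alpha> * cnj x) = Im (cnj \<gamma> * cnj y)"
  proof -
    have "- 2 * Im (cnj \<alpha> * cnj x) / cmod x ^ 4 = - 2 * Im (cnj \<gamma> * cnj y) / cmod y ^ 4"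
      using der2 unfolding disc_aut_jet(2)[OF SU(1) z] disc_aut_jet(2)[OF SU(2) z]
      by (simp only: x_def[symmetric] y_def[symmetric])
    then show ?thesis using nz by (simp add: norm')
  qed
  ultimately have prod: "cnj \<alpha> * cnj x = cnj \<gamma> * cnj y"
    by (rule complex_eqI)
  have znz: "z \<noteq> 0" using z by auto
  from sign have "(\<gamma> = \<alpha> \<and> \<delta> = \<beta>) \<or> (\<gamma> = - \<alpha> \<and> \<delta> = - \<beta>)"
  proof
    assume "y = x"
    with prod nz have "cnj \<gamma> = cnj \<alpha>" by simp
    moreover from this \<open>y = x\<close> have "cnj \<delta> * z = cnj \<beta> * z" by (simp add: x_def y_def)
    ultimately show ?thesis using znz by simp
  next
    assume "y = - x"
    with prod have "(cnj \<gamma> + cnj \<alpha>) * cnj x = 0" by (simp add: distrib_right)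
    then have "cnj (\<gamma> + \<alpha>) = 0" using nz by simp
    then have \<gamma>: "\<gamma> = - \<alpha>" by (simp only: complex_cnj_zero_iff eq_neg_iff_add_eq_0)
    have "(cnj \<delta> + cnj \<beta>) * z = 0"
      using \<open>y = - x\<close> by (simp add: x_def y_def \<gamma> distrib_right eq_neg_iff_add_eq_0)
    then have "cnj (\<delta> + \<beta>) = 0" using znz by simp
    then have "\<delta> = - \<beta>" by (simp only: complex_cnj_zero_iff eq_neg_iff_add_eq_0)
    with \<gamma> show ?thesis by simp
  qed
  then show ?thesis using disc_aut_uminus by auto
qed

section \<open>Triangular matrices in moving frames\<close>

text \<open>
  The rotation by the angle \<open>- s\<close>, followed by the action of the real matrix with rows \<open>(p, q)\<close> and
  \<open>(0, 1/p)\<close>, which fixes \<open>1\<close> (the image of infinity under the Cayley transform), followed by the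
  rotation by the angle \<open>t\<close>. It maps \<open>cis s\<close> to \<open>cis t\<close>.
\<close>

definition framed_Moebius :: "real \<Rightarrow> real \<Rightarrow> real \<Rightarrow> real \<Rightarrow> complex \<Rightarrow> complex" where
  "framed_Moebius p q t s =
     disc_aut (Complex ((p + 1 / p) / 2) (q / 2) * cis ((t - s) / 2))
       (Complex ((p - 1 / p) / 2) (- q / 2) * cis ((t + s) / 2))"

lemma SU11_framed:
  assumes "p \<noteq> 0"
  shows "SU11 (Complex ((p + 1 / p) / 2) (q / 2) * cis \<theta>) (Complex ((p - 1 / p) / 2) (- q / 2) * cis \<theta>')"
proof -
  have "((p + 1 / p) / 2)\<^sup>2 - ((p - 1 / p) / 2)\<^sup>2 = 1"
    using assms by (simp add: power2_eq_square field_simps)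
  then show ?thesis
    unfolding norm_mult norm_cis by (simp add: cmod_power2)
qed

lemma framed_Moebius_in_Moebius: "p \<noteq> 0 \<Longrightarrow> framed_Moebius p q t s \<in> Moebius"
  unfolding framed_Moebius_def Moebius_iff_disc_aut using SU11_framed by blast

lemma framed_Moebius_Bij: "p \<noteq> 0 \<Longrightarrow> framed_Moebius p q t s \<in> Bij circle"
  unfolding framed_Moebius_def by (intro disc_aut_Bij SU11_framed)

lemma framed_Moebius_id: "framed_Moebius 1 0 s s = \<one>\<^bsub>circle_group\<^esub>"
  unfolding framed_Moebius_def disc_aut_one[symmetric]
  by (simp add: Complex_eq)

text \<open>
  When the intermediate frames agree, the two rotations in the middle cancel and the triangular
  matrices multiply.
\<close>

lemma framed_Moebius_mult:
  assumes "p \<noteq> 0" "p' \<noteq> 0"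
  shows "framed_Moebius p q r t \<otimes>\<^bsub>circle_group\<^esub> framed_Moebius p' q' t s =
    framed_Moebius (p * p') (p * q' + q / p') r s"
proof -
  define A B where "A = Complex ((p + 1 / p) / 2) (q / 2)" and "B = Complex ((p - 1 / p) / 2) (- q / 2)"
  define A' B' where "A' = Complex ((p' + 1 / p') / 2) (q' / 2)"
    and "B' = Complex ((p' - 1 / p') / 2) (- q' / 2)"
  have A: "A * A' + B * cnj B' = Complex ((p * p' + 1 / (p * p')) / 2) ((p * q' + q / p') / 2)"
    using assms by (simp add: A_def A'_def B_def B'_def complex_eq_iff field_simps)
  have B: "A * B' + B * cnj A' = Complex ((p * p' - 1 / (p * p')) / 2) (- (p * q' + q / p') / 2)"
    using assms by (simp add: A_def A'_def B_def B'_def complex_eq_iff field_simps)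
  have rot: "cis ((r - t) / 2) * cis ((t - s) / 2) = cis ((r - s) / 2)"
    "cis ((r + t) / 2) * cis (- ((t + s) / 2)) = cis ((r - s) / 2)"
    "cis ((r - t) / 2) * cis ((t + s) / 2) = cis ((r + s) / 2)"
    "cis ((r + t) / 2) * cis (- ((t - s) / 2)) = cis ((r + s) / 2)"
    unfolding cis_mult by (rule arg_cong[where f = cis], simp add: field_simps)+
  have "(A * cis ((r - t) / 2)) * (A' * cis ((t - s) / 2)) +
        (B * cis ((r + t) / 2)) * cnj (B' * cis ((t + s) / 2)) =
      A * A' * (cis ((r - t) / 2) * cis ((t - s) / 2)) + B * cnj B' * (cis ((r + t) / 2) * cis (- ((t + s) / 2)))"
    by (simp add: cis_cnj mult.assoc mult.left_commute del: cis_mult)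
  then have 1: "(A * cis ((r - t) / 2)) * (A' * cis ((t - s) / 2)) +
        (B * cis ((r + t) / 2)) * cnj (B' * cis ((t + s) / 2)) = (A * A' + B * cnj B') * cis ((r - s) / 2)"
    unfolding rot by (simp only: distrib_right)
  have "(A * cis ((r - t) / 2)) * (B' * cis ((t + s) / 2)) +
        (B * cis ((r + t) / 2)) * cnj (A' * cis ((t - s) / 2)) =
      A * B' * (cis ((r - t) / 2) * cis ((t + s) / 2)) + B * cnj A' * (cis ((r + t) / 2) * cis (- ((t - s) / 2)))"
    by (simp only: complex_cnj_mult cis_cnj mult.assoc mult.left_commute)
  then have 2: "(A * cis ((r - t) / 2)) * (B' * cis ((t + s) / 2)) +
        (B * cis ((r + t) / 2)) * cnj (A' * cis ((t - s) / 2)) = (A * B' + B * cnj A') * cis ((r + s) / 2)"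
    unfolding rot by (simp only: distrib_right)
  show ?thesis
    unfolding framed_Moebius_def disc_aut_mult[OF SU11_framed[OF assms(1)] SU11_framed[OF assms(2)]]
    unfolding A_def[symmetric] B_def[symmetric] A'_def[symmetric] B'_def[symmetric] 1 2
    unfolding A B ..
qed

lemma framed_Moebius_inv:
  assumes "p \<noteq> 0"
  shows "inv\<^bsub>circle_group\<^esub> (framed_Moebius p 0 t s) = framed_Moebius (1 / p) 0 s t"
proof -
  interpret group circle_group by (rule group_BijGroup)
  show ?thesis
    using assms
    by (intro inv_equality)
      (simp_all add: framed_Moebius_mult framed_Moebius_id circle_group_carrier framed_Moebius_Bij)
qed

lemma framed_Moebius_jet:
  assumes "p > 0"
  shows "framed_Moebius p q t s (cis s) = cis t"
    and "circle_deriv (framed_Moebius p q t s) (cis s) = 1 / p\<^sup>2"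
    and "circle_deriv2 (framed_Moebius p q t s) (cis s) = q / p ^ 3"
proof -
  define A B where "A = Complex ((p + 1 / p) / 2) (q / 2)" and "B = Complex ((p - 1 / p) / 2) (- q / 2)"
  define \<alpha> \<beta> where "\<alpha> = A * cis ((t - s) / 2)" and "\<beta> = B * cis ((t + s) / 2)"
  have SU: "SU11 \<alpha> \<beta>"
    unfolding \<alpha>_def \<beta>_def A_def B_def using assms by (intro SU11_framed) simp
  have F: "framed_Moebius p q t s = disc_aut \<alpha> \<beta>"
    by (simp add: framed_Moebius_def \<alpha>_def \<beta>_def A_def B_def)
  have z: "cis s \<in> circle" by simp
  have "cnj A + cnj B = of_real p" by (simp add: A_def B_def complex_eq_iff field_simps)
  moreover have "cis (- ((t + s) / 2)) * cis s = cis (- ((t - s) / 2))"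
    unfolding cis_mult by (rule arg_cong[where f = cis]) (simp add: field_simps)
  ultimately have y: "cnj \<beta> * cis s + cnj \<alpha> = of_real p * cis (- ((t - s) / 2))"
    unfolding \<alpha>_def \<beta>_def complex_cnj_mult cis_cnj
    by (metis add.commute distrib_right mult.assoc)
  have "disc_aut \<alpha> \<beta> (cis s) = cis s * cis ((t - s) / 2) / cis (- ((t - s) / 2))"
    unfolding disc_aut_apply[OF z] y using assms by (simp add: cis_cnj)
  also have "\<dots> = cis t"
    by (simp only: cis_mult cis_divide) (simp add: field_simps)
  finally show "framed_Moebius p q t s (cis s) = cis t" by (simp only: F)
  have ny: "cmod (cnj \<beta> * cis s + cnj \<alpha>) = p"
    unfolding y using assms by (simp add: norm_mult)
  show "circle_deriv (framed_Moebius p q t s) (cis s) = 1 / p\<^sup>2"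
    unfolding F disc_aut_jet(1)[OF SU z] ny ..
  have "cnj \<alpha> * cnj (of_real p * cis (- ((t - s) / 2))) = of_real p * cnj A * (cis (- ((t - s) / 2)) * cis ((t - s) / 2))"
    by (simp add: \<alpha>_def cis_cnj)
  also have "cis (- ((t - s) / 2)) * cis ((t - s) / 2) = 1" by (simp add: cis_mult)
  finally have eq: "cnj \<alpha> * cnj (of_real p * cis (- ((t - s) / 2))) = of_real p * cnj A * 1" .
  have im: "Im (cnj \<alpha> * cnj (of_real p * cis (- ((t - s) / 2)))) = - p * q / 2"
    unfolding eq by (simp add: A_def)
  show "circle_deriv2 (framed_Moebius p q t s) (cis s) = q / p ^ 3"
    unfolding F disc_aut_jet(2)[OF SU z] ny unfolding y im
    using assms by (simp add: field_simps power4_eq_xxxx power3_eq_cube)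
qed

text \<open>
  Triangular matrices with \<open>p > 0\<close> realise all 2-jets with positive derivative; uniqueness of the
  Moebius transformation with a given 2-jet does the rest.
\<close>

lemma projective_derivative_eq_framed:
  assumes "f (cis s) = cis t" and "p > 0"
    and "circle_deriv f (cis s) = 1 / p\<^sup>2" and "circle_deriv2 f (cis s) = q / p ^ 3"
  shows "projective_derivative f (cis s) = framed_Moebius p q t s"
  unfolding projective_derivative_def
proof (rule the_equality)
  have p: "p \<noteq> 0" using assms(2) by simp
  show "framed_Moebius p q t s \<in> Moebius \<and> framed_Moebius p q t s (cis s) = f (cis s) \<and>
    circle_deriv (framed_Moebius p q t s) (cis s) = circle_deriv f (cis s) \<and>
    circle_deriv2 (framed_Moebius p q t s) (cis s) = circle_deriv2 f (cis s)"
    using framed_Moebius_in_Moebius[OF p] framed_Moebius_jet[OF assms(2)] assms by simp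
  fix P assume P: "P \<in> Moebius \<and> P (cis s) = f (cis s) \<and>
    circle_deriv P (cis s) = circle_deriv f (cis s) \<and> circle_deriv2 P (cis s) = circle_deriv2 f (cis s)"
  then obtain \<alpha> \<beta> where ab: "SU11 \<alpha> \<beta>" "P = disc_aut \<alpha> \<beta>"
    using Moebius_iff_disc_aut by blast
  show "P = framed_Moebius p q t s"
    using P framed_Moebius_jet[OF assms(2), of q t s] assms
    unfolding ab(2) framed_Moebius_def
    by (intro disc_aut_eqI_jet[OF ab(1) SU11_framed[OF p], of "cis s"]) auto
qed

text \<open>
  The coefficients change sign when \<open>s\<close> grows by \<open>2 * pi\<close>, but the 2-jet at \<open>cis s\<close> does not change.
\<close>

lemma framed_Moebius_angle_cong:
  assumes "p > 0" "cis s = cis s'"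
  shows "framed_Moebius p q t s = framed_Moebius p q t s'"
proof -
  have p: "p \<noteq> 0" using assms by simp
  show ?thesis
    using framed_Moebius_jet[OF assms(1), of q t s] framed_Moebius_jet[OF assms(1), of q t s']
    unfolding assms(2) unfolding framed_Moebius_def
    by (intro disc_aut_eqI_jet[OF SU11_framed[OF p] SU11_framed[OF p], of "cis s'"]) auto
qed

lemma continuous_map_framed_Moebius:
  fixes p q t s :: "'a::topological_space \<Rightarrow> real"
  assumes "continuous_on X p" "continuous_on X q" "continuous_on X t" "continuous_on X s"
    and "\<And>x. x \<in> X \<Longrightarrow> p x \<noteq> 0"
  shows "continuous_map (top_of_set X) Moebius_topology (\<lambda>x. framed_Moebius (p x) (q x) (t x) (s x))"
  unfolding framed_Moebius_def Complex_eq
  using assms SU11_framed[unfolded Complex_eq]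
  by (intro continuous_map_disc_aut continuous_intros) (auto simp del: of_real_add of_real_diff of_real_divide)

lemma continuous_map_frame:
  fixes w :: "complex \<Rightarrow> real"
  assumes "continuous_on circle w"
  shows "continuous_map (top_of_set circle) Moebius_topology
    (\<lambda>z. framed_Moebius (exp (w z)) 0 0 (Arg z))"
proof (rule continuous_map_circleI)
  have "continuous_on UNIV (\<lambda>t. w (cis t))"
    by (rule continuous_on_compose2[OF assms]) (auto intro: continuous_intros)
  then have "continuous_on UNIV (\<lambda>t. exp (w (cis t)))" by (rule continuous_on_exp)
  then have "continuous_map (top_of_set UNIV) Moebius_topology (\<lambda>t. framed_Moebius (exp (w (cis t))) 0 0 t)"
    by (rule continuous_map_framed_Moebius) (simp_all add: continuous_on_id)
  moreover have "framed_Moebius (exp (w (cis t))) 0 0 t = framed_Moebius (exp (w (cis t))) 0 0 (Arg (cis t))" for t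
    by (rule framed_Moebius_angle_cong) (simp_all add: cis_Arg_circle)
  ultimately show "continuous_map euclideanreal Moebius_topology
      (\<lambda>t. framed_Moebius (exp (w (cis t))) 0 0 (Arg (cis t)))"
    by simp
qed

text \<open>
  The effect of the diagonal change of frame on the triangular cocycle: the corner \<open>q\<close> is multiplied by
  both \<open>p1\<close> and \<open>p2\<close>, whereas only their ratio acts on the diagonal.
\<close>

lemma frame_conjugate:
  assumes "p1 \<noteq> 0" "p2 \<noteq> 0" "p \<noteq> 0"
  shows "framed_Moebius p1 0 0 t \<otimes>\<^bsub>circle_group\<^esub> framed_Moebius p q t s
      \<otimes>\<^bsub>circle_group\<^esub> inv\<^bsub>circle_group\<^esub> (framed_Moebius p2 0 0 s) =
    framed_Moebius (p1 * p / p2) (p1 * q * p2) 0 0"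
  using assms by (simp add: framed_Moebius_inv framed_Moebius_mult)

lemma framed_Moebius_near_identity:
  assumes d: "left_invariant_Moebius_metric d" and "\<epsilon> > 0"
  obtains \<eta> where "\<eta> > 0"
    "\<forall>p q. \<bar>p - 1\<bar> < \<eta> \<longrightarrow> \<bar>q\<bar> < \<eta> \<longrightarrow> d (framed_Moebius p q 0 0) \<one>\<^bsub>circle_group\<^esub> < \<epsilon>"
proof -
  interpret Metric_space Moebius d
    using d by (simp add: left_invariant_Moebius_metric_def)
  have top: "mtopology = Moebius_topology"
    using d by (simp add: left_invariant_Moebius_metric_def)
  define X where "X = {x :: real \<times> real. fst x > 0}"
  have "open X" unfolding X_def by (intro open_Collect_less continuous_intros)
  have one: "\<one>\<^bsub>circle_group\<^esub> \<in> Moebius"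
    using framed_Moebius_in_Moebius[of 1 0 0 0] by (simp add: framed_Moebius_id)
  define V where "V = {x \<in> X. framed_Moebius (fst x) (snd x) 0 0 \<in> mball \<one>\<^bsub>circle_group\<^esub> \<epsilon>}"
  have cont: "continuous_map (top_of_set X) Moebius_topology (\<lambda>x. framed_Moebius (fst x) (snd x) 0 0)"
    by (intro continuous_map_framed_Moebius continuous_intros) (auto simp: X_def)
  have ball: "openin Moebius_topology (mball \<one>\<^bsub>circle_group\<^esub> \<epsilon>)"
    unfolding top[symmetric] by simp
  have "openin (top_of_set X) V"
    using openin_continuous_map_preimage[OF cont ball] by (simp add: V_def)
  then have "open V" using \<open>open X\<close> by (simp add: openin_open_eq)
  moreover have "(1, 0) \<in> V"
    using one \<open>\<epsilon> > 0\<close> by (simp add: V_def X_def framed_Moebius_id)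
  ultimately obtain e where e: "e > 0" "\<And>y. dist y (1, 0) < e \<Longrightarrow> y \<in> V"
    unfolding open_dist by blast
  show ?thesis
  proof (rule that[of "e / 2"], use e in simp, intro allI impI)
    fix p q :: real assume pq: "\<bar>p - 1\<bar> < e / 2" "\<bar>q\<bar> < e / 2"
    have "dist (p, q) (1, 0) \<le> \<bar>p - 1\<bar> + \<bar>q\<bar>"
      using sqrt_sum_squares_le_sum_abs[of "p - 1" q] by (simp add: dist_Pair_Pair dist_real_def)
    then have "(p, q) \<in> V" using pq by (intro e(2)) simp
    then show "d (framed_Moebius p q 0 0) \<one>\<^bsub>circle_group\<^esub> < \<epsilon>"
      by (simp add: V_def commute)
  qed
qed

section \<open>Reduction of the projective cocycle\<close>

locale free_C2_circle_group =
  fixes \<Gamma> :: "(complex \<Rightarrow> complex) set"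
  assumes subgroup: "subgroup \<Gamma> circle_group"
    and diffeos: "\<Gamma> \<subseteq> C2_circle_diffeos"
    and free: "\<And>f z. f \<in> \<Gamma> \<Longrightarrow> f \<noteq> \<one>\<^bsub>circle_group\<^esub> \<Longrightarrow> z \<in> circle \<Longrightarrow> f z \<noteq> z"
begin

lemma C2: "f \<in> \<Gamma> \<Longrightarrow> f \<in> C2_circle_diffeos"
  using diffeos by blast

lemma Bij: "f \<in> \<Gamma> \<Longrightarrow> f \<in> Bij circle"
  using diffeos C2_circle_diffeo_Bij by blast

lemma apply_circle: "f \<in> \<Gamma> \<Longrightarrow> z \<in> circle \<Longrightarrow> f z \<in> circle"
  using Bij Bij_circle_apply by blast

lemma funpow_in_group:
  assumes "f \<in> \<Gamma>"
  shows "\<exists>h\<in>\<Gamma>. \<forall>z\<in>circle. h z = (f ^^ m) z"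
proof (induction m)
  case 0
  show ?case
    using subgroup.one_closed[OF subgroup] circle_group_one_apply by (intro bexI[of _ "\<one>\<^bsub>circle_group\<^esub>"]) auto
next
  case (Suc m)
  then obtain h where h: "h \<in> \<Gamma>" "\<forall>z\<in>circle. h z = (f ^^ m) z" by blast
  then have "\<forall>z\<in>circle. (f \<otimes>\<^bsub>circle_group\<^esub> h) z = (f ^^ Suc m) z"
    using circle_group_mult_apply[OF Bij[OF assms] Bij[OF h(1)]] by (metis comp_apply funpow.simps(2))
  then show ?case using subgroup.m_closed[OF subgroup assms h(1)] by blast
qed

text \<open>
  By freeness, a power of \<open>f\<close> with a fixed point is the identity. This also covers elements of finite
  order.
\<close>

lemma log_deriv_growth_lower:
  assumes f: "f \<in> \<Gamma>" and "\<delta> > 0"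
  shows "\<exists>N0. \<forall>N\<ge>N0. \<forall>z\<in>circle. Birkhoff_sum f (log_deriv f) N z > - \<delta> * N"
proof -
  have fC2: "f \<in> C2_circle_diffeos" using f diffeos by blast
  obtain F where F: "is_lift f F" and F': "\<forall>t. (F has_real_derivative circle_deriv f (cis t)) (at t)"
    using C2_circle_diffeo_lift[OF fC2] by blast
  have "\<exists>N0. \<forall>N\<ge>N0. \<forall>x. Birkhoff_sum F (\<lambda>t. log_deriv f (cis t)) N x > - \<delta> * N"
  proof (rule Birkhoff_sum_lower_bound[OF continuous_on_log_deriv[OF fC2] _ _ \<open>\<delta> > 0\<close>])
    show "(F has_real_derivative exp (log_deriv f (cis t))) (at t)" for t
      using F' by (simp add: exp_log_deriv[OF fC2])
    fix m s and q :: int assume "(F ^^ m) s = s + 2 * pi * of_int q"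
    obtain h where h: "h \<in> \<Gamma>" "\<forall>z\<in>circle. h z = (f ^^ m) z"
      using funpow_in_group[OF f] by blast
    have "h (cis s) = cis ((F ^^ m) s)" using h(2) cis_funpow_lift[OF F, of m s] by simp
    also have "\<dots> = cis s"
      unfolding \<open>(F ^^ m) s = _\<close> by (simp add: cis_mult[symmetric])
    finally have "h = \<one>\<^bsub>circle_group\<^esub>" using free[OF h(1), of "cis s"] by auto
    then have "is_lift (\<lambda>z. z) (F ^^ m)"
      using h(2) F cis_funpow_lift[OF F, of m] circle_group_one_apply
      by (auto simp: is_lift_def intro!: continuous_on_funpow)
    moreover have "is_lift (\<lambda>z. z) (\<lambda>t. t)" by (simp add: is_lift_def)
    ultimately obtain k :: int where k: "\<forall>t. (F ^^ m) t = t + 2 * pi * of_int k"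
      using is_lift_unique by blast
    with \<open>(F ^^ m) s = _\<close> show "\<forall>t. (F ^^ m) t = t + 2 * pi * of_int q" by auto
  qed
  moreover have "Birkhoff_sum F (\<lambda>t. log_deriv f (cis t)) N (Arg z) = Birkhoff_sum f (log_deriv f) N z"
    if "z \<in> circle" for N z
    unfolding Birkhoff_sum_def cis_funpow_lift[OF F] cis_Arg_circle[OF that] ..
  ultimately show ?thesis by metis
qed

lemma log_deriv_inverse:
  assumes "f \<in> \<Gamma>" "z \<in> circle"
  shows "log_deriv (inv\<^bsub>circle_group\<^esub> f) (f z) = - log_deriv f z"
proof -
  interpret group circle_group by (rule group_BijGroup)
  have inv: "inv\<^bsub>circle_group\<^esub> f \<in> \<Gamma>" using subgroup.m_inv_closed[OF subgroup assms(1)] .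
  have "inv\<^bsub>circle_group\<^esub> f \<otimes>\<^bsub>circle_group\<^esub> f = \<one>\<^bsub>circle_group\<^esub>"
    using Bij[OF assms(1)] by (intro l_inv) (simp add: circle_group_carrier)
  then show ?thesis
    using log_deriv_mult[OF C2[OF inv] C2[OF assms(1)] assms(2)] log_deriv_one[OF assms(2)] by simp
qed

text \<open>
  The orbit of \<open>f\<close> traversed backwards is an orbit of the inverse, with the opposite Birkhoff sum.
\<close>

lemma log_deriv_growth:
  fixes \<delta> :: real
  assumes f: "f \<in> \<Gamma>" and "\<delta> > 0"
  shows "\<exists>N0. \<forall>N\<ge>N0. \<forall>z\<in>circle. \<bar>Birkhoff_sum f (log_deriv f) N z\<bar> \<le> \<delta> * N"
proof -
  define g where "g = inv\<^bsub>circle_group\<^esub> f"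
  have g: "g \<in> \<Gamma>" unfolding g_def using subgroup.m_inv_closed[OF subgroup f] .
  have orbit: "(f ^^ n) z \<in> circle" if "z \<in> circle" for n z
    using that apply_circle[OF f] by (induction n) auto
  have reverse: "Birkhoff_sum g (log_deriv g) N ((f ^^ N) z) = - Birkhoff_sum f (log_deriv f) N z"
    if "z \<in> circle" for N z
  proof (induction N)
    case (Suc N)
    define y where "y = (f ^^ N) z"
    have y: "y \<in> circle" unfolding y_def by (rule orbit[OF that])
    have "Birkhoff_sum g (log_deriv g) (1 + N) (f y) =
        log_deriv g (f y) + Birkhoff_sum g (log_deriv g) N (g (f y))"
      unfolding Birkhoff_sum_add by simp
    then show ?case
      using Suc log_deriv_inverse[OF f y] circle_group_inv_apply(1)[OF Bij[OF f] y]
      by (simp add: y_def g_def del: Birkhoff_sum_Suc) simp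
  qed simp
  obtain N1 where N1: "\<forall>N\<ge>N1. \<forall>z\<in>circle. Birkhoff_sum f (log_deriv f) N z > - \<delta> * N"
    using log_deriv_growth_lower[OF f \<open>\<delta> > 0\<close>] by blast
  obtain N2 where N2: "\<forall>N\<ge>N2. \<forall>z\<in>circle. Birkhoff_sum g (log_deriv g) N z > - \<delta> * N"
    using log_deriv_growth_lower[OF g \<open>\<delta> > 0\<close>] by blast
  show ?thesis
  proof (intro exI[of _ "max N1 N2"] allI impI ballI)
    fix N z assume N: "max N1 N2 \<le> N" and z: "z \<in> circle"
    have "Birkhoff_sum f (log_deriv f) N z > - \<delta> * N" using N1 N z by auto
    moreover have "Birkhoff_sum g (log_deriv g) N ((f ^^ N) z) > - \<delta> * N"
      using N2 N orbit[OF z, of N] by auto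
    ultimately show "\<bar>Birkhoff_sum f (log_deriv f) N z\<bar> \<le> \<delta> * N"
      using reverse[OF z, of N] by simp
  qed
qed

text \<open>
  On the generators the functions come from \<open>almost_coboundary\<close>. The defect is itself a cocycle, so
  its uniform convergence to \<open>0\<close> passes to products and inverses.
\<close>

lemma log_deriv_asymptotic_coboundary:
  assumes comm: "\<And>f g. f \<in> \<Gamma> \<Longrightarrow> g \<in> \<Gamma> \<Longrightarrow> f \<otimes>\<^bsub>circle_group\<^esub> g = g \<otimes>\<^bsub>circle_group\<^esub> f"
    and A: "finite A" "A \<subseteq> \<Gamma>" "generate circle_group A = \<Gamma>"
  shows "\<exists>u :: nat \<Rightarrow> complex \<Rightarrow> real. (\<forall>n. continuous_on circle (u n)) \<and>
    (\<forall>f\<in>\<Gamma>. uniform_limit circle (\<lambda>n z. log_deriv f z + u n (f z) - u n z) (\<lambda>_. 0) sequentially)"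
proof -
  interpret group circle_group by (rule group_BijGroup)
  have A\<Gamma>: "f \<in> \<Gamma>" if "f \<in> A" for f using A that by blast
  have "\<exists>u. continuous_on circle u \<and> (\<forall>f\<in>A. \<forall>z\<in>circle. \<bar>log_deriv f z + u (f z) - u z\<bar> \<le> 1 / Suc n)" for n
  proof (rule almost_coboundary)
    show "f ` circle \<subseteq> circle" if "f \<in> A" for f using apply_circle[OF A\<Gamma>[OF that]] by blast
    show "continuous_on circle f" if "f \<in> A" for f
      using C2_circle_diffeo_lift[of f] A\<Gamma>[OF that] diffeos continuous_on_circle_map by blast
    show "continuous_on circle (log_deriv f)" if "f \<in> A" for f
      using continuous_on_log_deriv A\<Gamma>[OF that] diffeos by blast
    fix f g z assume fg: "f \<in> A" "g \<in> A" and z: "z \<in> circle"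
    note fg = A\<Gamma>[OF fg(1)] A\<Gamma>[OF fg(2)]
    show "f (g z) = g (f z)"
      using comm[OF fg] circle_group_mult_apply[OF Bij[OF fg(1)] Bij[OF fg(2)] z]
        circle_group_mult_apply[OF Bij[OF fg(2)] Bij[OF fg(1)] z] by simp
    show "log_deriv f (g z) + log_deriv g z = log_deriv g (f z) + log_deriv f z"
      using comm[OF fg] log_deriv_mult[OF C2[OF fg(1)] C2[OF fg(2)] z]
        log_deriv_mult[OF C2[OF fg(2)] C2[OF fg(1)] z] by simp
  next
    show "\<exists>N0. \<forall>N\<ge>N0. \<forall>z\<in>circle. \<bar>Birkhoff_sum f (log_deriv f) N z\<bar> \<le> e * N"
      if "f \<in> A" "e > 0" for f and e :: real
      using log_deriv_growth[OF A\<Gamma>[OF that(1)] that(2)] .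
  qed (use A in auto)
  then obtain u where u: "\<forall>n. continuous_on circle (u n)"
    and small: "\<forall>n. \<forall>f\<in>A. \<forall>z\<in>circle. \<bar>log_deriv f z + u n (f z) - u n z\<bar> \<le> 1 / Suc n"
    by metis
  define \<epsilon> where "\<epsilon> f n z = log_deriv f z + u n (f z) - u n z" for f n z
  have "uniform_limit circle (\<epsilon> f) (\<lambda>_. 0) sequentially" if "f \<in> A" for f
  proof (rule uniform_limitI)
    fix e :: real assume "e > 0"
    then obtain n0 where "1 / Suc n0 < e" using nat_approx_posE by blast
    show "\<forall>\<^sub>F n in sequentially. \<forall>z\<in>circle. dist (\<epsilon> f n z) 0 < e"
      using eventually_ge_at_top[of n0]
    proof eventually_elim
      case (elim n)
      then have "1 / Suc n \<le> 1 / Suc n0" by (simp add: field_simps)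
      moreover have "\<bar>\<epsilon> f n z\<bar> \<le> 1 / Suc n" if "z \<in> circle" for z
        using small \<open>f \<in> A\<close> that by (simp only: \<epsilon>_def)
      ultimately have "\<bar>\<epsilon> f n z\<bar> < e" if "z \<in> circle" for z
        using \<open>1 / Suc n0 < e\<close> that by (meson le_less_trans)
      then show ?case unfolding dist_real_def diff_zero by blast
    qed
  qed
  note gen = this
  have "uniform_limit circle (\<epsilon> f) (\<lambda>_. 0) sequentially" if "f \<in> generate circle_group A" for f
    using that
  proof (induction rule: generate.induct)
    case one
    have "\<epsilon> \<one>\<^bsub>circle_group\<^esub> n z = 0" if "z \<in> circle" for n z
      using that by (simp add: \<epsilon>_def log_deriv_one circle_group_one_apply)
    then show ?case by (auto intro!: uniform_limitI)
  next
    case (incl h)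
    then show ?case by (rule gen)
  next
    case (inv h)
    note h = A\<Gamma>[OF inv]
    let ?g = "inv\<^bsub>circle_group\<^esub> h"
    have g: "?g \<in> \<Gamma>" using subgroup.m_inv_closed[OF subgroup h] .
    have eq: "\<epsilon> ?g n z = - \<epsilon> h n (?g z)" if z: "z \<in> circle" for n z
      using log_deriv_inverse[OF h apply_circle[OF g z]] circle_group_inv_apply(2)[OF Bij[OF h] z]
      by (simp add: \<epsilon>_def)
    show ?case
    proof (rule uniform_limitI)
      fix e :: real assume "e > 0"
      from uniform_limitD[OF gen[OF inv] this]
      show "\<forall>\<^sub>F n in sequentially. \<forall>z\<in>circle. dist (\<epsilon> ?g n z) 0 < e"
        by eventually_elim (use eq apply_circle[OF g] in auto)
    qed
  next
    case (eng h1 h2)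
    then have h: "h1 \<in> \<Gamma>" "h2 \<in> \<Gamma>" using A by auto
    have eq: "\<epsilon> (h1 \<otimes>\<^bsub>circle_group\<^esub> h2) n z = \<epsilon> h1 n (h2 z) + \<epsilon> h2 n z" if z: "z \<in> circle" for n z
      using log_deriv_mult[OF C2[OF h(1)] C2[OF h(2)] z] circle_group_mult_apply[OF Bij[OF h(1)] Bij[OF h(2)] z]
      by (simp add: \<epsilon>_def)
    show ?case
    proof (rule uniform_limitI)
      fix e :: real assume "e > 0"
      then have "e / 2 > 0" by simp
      from uniform_limitD[OF eng.IH(1) this] uniform_limitD[OF eng.IH(2) this]
      show "\<forall>\<^sub>F n in sequentially. \<forall>z\<in>circle. dist (\<epsilon> (h1 \<otimes>\<^bsub>circle_group\<^esub> h2) n z) 0 < e"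
      proof eventually_elim
        case (elim n)
        show ?case
        proof
          fix z assume z: "z \<in> circle"
          have "dist (\<epsilon> h1 n (h2 z)) 0 < e / 2" "dist (\<epsilon> h2 n z) 0 < e / 2"
            using elim z apply_circle[OF h(2) z] by blast+
          then show "dist (\<epsilon> (h1 \<otimes>\<^bsub>circle_group\<^esub> h2) n z) 0 < e"
            unfolding eq[OF z] dist_real_def by simp
        qed
      qed
    qed
  qed
  then show ?thesis using u A(3) unfolding \<epsilon>_def[abs_def] by blast
qed

text \<open>
  The frame at \<open>z\<close> is diagonal with entries \<open>exp (w n z)\<close> and \<open>exp (- w n z)\<close> in the basis adapted to
  \<open>z\<close>. The factor \<open>- 1/2\<close> in \<open>w\<close> is the exponent in \<open>p = (Df) powr (- 1/2)\<close>; the constant \<open>c n + n\<close>, with \<open>c n\<close> a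
  bound of \<open>u n\<close>, forces \<open>w n \<le> - n / 2\<close> and thereby kills the corner entry. The conjugated cocycle
  converges to the identity, which is a rotation.
\<close>

lemma almost_reducible:
  assumes d: "left_invariant_Moebius_metric d"
    and u: "\<forall>n. continuous_on circle (u n)"
    and lim: "\<forall>f\<in>\<Gamma>. uniform_limit circle (\<lambda>n z. log_deriv f z + u n (f z) - u n z) (\<lambda>_. 0) sequentially"
  shows "almost_SO2_reducible d \<Gamma> projective_derivative"
proof -
  interpret Metric_space Moebius d
    using d by (simp add: left_invariant_Moebius_metric_def)
  have "\<exists>c. \<forall>z\<in>circle. \<bar>u n z\<bar> \<le> c" for n
    using compact_imp_bounded[OF compact_continuous_image[OF u[rule_format, of n]]]
    by (simp add: bounded_iff)
  then obtain c where c: "\<forall>n. \<forall>z\<in>circle. \<bar>u n z\<bar> \<le> c n" by metis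
  define w where "w n z = - (u n z + c n + n) / 2" for n z
  have w_le: "w n z \<le> - n / 2" if "z \<in> circle" for n z
    using abs_le_D2[OF c[rule_format, OF that, of n]] by (simp add: w_def)
  define B where "B n z = framed_Moebius (exp (w n z)) 0 0 (Arg z)" for n z
  have "continuous_map (top_of_set circle) Moebius_topology (B n)" for n
    unfolding B_def[abs_def] w_def[abs_def] using u
    by (intro continuous_map_frame continuous_intros) auto
  moreover have "uniform_limit circle
      (\<lambda>n z. INF r\<in>rotations. d (B n (f z) \<otimes>\<^bsub>circle_group\<^esub> projective_derivative f z
         \<otimes>\<^bsub>circle_group\<^esub> inv\<^bsub>circle_group\<^esub> (B n z)) r) (\<lambda>z. 0) sequentially"
    if f: "f \<in> \<Gamma>" for f
  proof (rule uniform_limitI)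
    fix e :: real assume "e > 0"
    have fC2: "f \<in> C2_circle_diffeos" using f diffeos by blast
    define \<epsilon> where "\<epsilon> n z = log_deriv f z + u n (f z) - u n z" for n z
    define p where "p z = exp (- log_deriv f z / 2)" for z
    define q where "q z = circle_deriv2 f z * p z ^ 3" for z
    have "continuous_on circle q"
      unfolding q_def p_def
      using continuous_on_log_deriv[OF fC2] C2_circle_diffeo_continuous_deriv2[OF fC2]
      by (intro continuous_intros) auto
    then have "compact (q ` circle)" by (intro compact_continuous_image) auto
    then obtain Q where Q: "\<forall>z\<in>circle. \<bar>q z\<bar> \<le> Q"
      using compact_imp_bounded by (fastforce simp: bounded_iff)
    have conj: "B n (f z) \<otimes>\<^bsub>circle_group\<^esub> projective_derivative f z \<otimes>\<^bsub>circle_group\<^esub> inv\<^bsub>circle_group\<^esub> (B n z) =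
        framed_Moebius (exp (- \<epsilon> n z / 2)) (exp (w n (f z) + w n z) * q z) 0 0"
      if z: "z \<in> circle" for n z
    proof -
      have "(p z)\<^sup>2 = exp (- log_deriv f z)"
        by (simp add: p_def exp_double[symmetric])
      then have p2: "1 / (p z)\<^sup>2 = circle_deriv f z"
        by (simp only: exp_log_deriv[OF fC2 z, symmetric] exp_minus inverse_eq_divide) simp
      have "projective_derivative f (cis (Arg z)) = framed_Moebius (p z) (q z) (Arg (f z)) (Arg z)"
      proof (rule projective_derivative_eq_framed)
        show "f (cis (Arg z)) = cis (Arg (f z))"
          using z apply_circle[OF f z] by (simp only: cis_Arg_circle)
        show "p z > 0" by (simp add: p_def)
        then show "circle_deriv2 f (cis (Arg z)) = q z / p z ^ 3"
          by (simp only: cis_Arg_circle[OF z]) (simp add: q_def)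
        show "circle_deriv f (cis (Arg z)) = 1 / (p z)\<^sup>2"
          by (simp only: cis_Arg_circle[OF z] p2)
      qed
      then have P: "projective_derivative f z = framed_Moebius (p z) (q z) (Arg (f z)) (Arg z)"
        by (simp only: cis_Arg_circle[OF z])
      have p_entry: "exp (w n (f z)) * p z / exp (w n z) = exp (- \<epsilon> n z / 2)"
        by (simp add: p_def w_def \<epsilon>_def exp_add[symmetric] exp_diff[symmetric] field_simps)
      have q_entry: "exp (w n (f z)) * q z * exp (w n z) = exp (w n (f z) + w n z) * q z"
        by (simp add: exp_add)
      have "p z \<noteq> 0" by (simp add: p_def)
      from frame_conjugate[OF exp_not_eq_zero exp_not_eq_zero this]
      show ?thesis
        unfolding P B_def by (simp only: p_entry q_entry)
    qed
    obtain \<eta> where \<eta>: "\<eta> > 0" and near: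
      "\<forall>p q. \<bar>p - 1\<bar> < \<eta> \<longrightarrow> \<bar>q\<bar> < \<eta> \<longrightarrow> d (framed_Moebius p q 0 0) \<one>\<^bsub>circle_group\<^esub> < e"
      by (rule framed_Moebius_near_identity[OF d \<open>e > 0\<close>])
    have "isCont (\<lambda>x::real. exp (- x / 2)) 0" by (intro continuous_intros) simp
    then obtain \<kappa> where \<kappa>: "\<kappa> > 0" "\<And>x::real. \<bar>x\<bar> < \<kappa> \<Longrightarrow> \<bar>exp (- x / 2) - 1\<bar> < \<eta>"
      using \<eta> unfolding continuous_at_eps_delta by (auto simp: dist_real_def)
    obtain n1 :: nat where n1: "n1 > Q / \<eta>" using reals_Archimedean2 by blast
    have small_q: "\<bar>exp (w n (f z) + w n z) * q z\<bar> < \<eta>" if z: "z \<in> circle" and n: "n \<ge> n1" for n z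
    proof -
      have "real n1 \<le> real n" using n by simp
      also have "\<dots> \<le> exp n" using exp_ge_add_one_self[of "real n"] by linarith
      finally have n1_le: "real n1 \<le> exp n" .
      have "Q < n1 * \<eta>" using n1 \<eta> by (simp add: field_simps)
      also have "\<dots> \<le> exp n * \<eta>"
        using n1_le \<eta> by (intro mult_right_mono) auto
      finally have "exp (- real n) * Q < \<eta>" by (simp add: exp_minus field_simps)
      moreover have "\<bar>exp (w n (f z) + w n z) * q z\<bar> \<le> exp (- real n) * Q"
        unfolding abs_mult
        using w_le[OF z, of n] w_le[OF apply_circle[OF f z], of n] Q z by (intro mult_mono) auto
      ultimately show ?thesis by simp
    qed
    have id_rot: "\<one>\<^bsub>circle_group\<^esub> \<in> rotations"
      unfolding rotations_def BijGroup_def by (auto intro!: exI[of _ 0])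
    from uniform_limitD[OF lim[rule_format, OF f] \<open>\<kappa> > 0\<close>] eventually_ge_at_top[of n1]
    show "\<forall>\<^sub>F n in sequentially. \<forall>z\<in>circle. dist (INF r\<in>rotations.
        d (B n (f z) \<otimes>\<^bsub>circle_group\<^esub> projective_derivative f z \<otimes>\<^bsub>circle_group\<^esub> inv\<^bsub>circle_group\<^esub> (B n z)) r) 0 < e"
    proof eventually_elim
      case (elim n)
      show ?case
      proof
        fix z assume z: "z \<in> circle"
        define X where "X = B n (f z) \<otimes>\<^bsub>circle_group\<^esub> projective_derivative f z \<otimes>\<^bsub>circle_group\<^esub> inv\<^bsub>circle_group\<^esub> (B n z)"
        have "\<bar>\<epsilon> n z\<bar> < \<kappa>" using elim(1) z by (simp add: \<epsilon>_def)
        then have "d X \<one>\<^bsub>circle_group\<^esub> < e"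
          unfolding X_def conj[OF z] using near \<kappa>(2) small_q[OF z elim(2)] by blast
        moreover have "(INF r\<in>rotations. d X r) \<le> d X \<one>\<^bsub>circle_group\<^esub>"
          by (rule cINF_lower[OF _ id_rot]) (auto intro!: bdd_belowI[of _ 0])
        moreover have "(INF r\<in>rotations. d X r) \<ge> 0"
          using id_rot by (intro cINF_greatest) auto
        ultimately show "dist (INF r\<in>rotations. d (B n (f z) \<otimes>\<^bsub>circle_group\<^esub> projective_derivative f z
            \<otimes>\<^bsub>circle_group\<^esub> inv\<^bsub>circle_group\<^esub> (B n z)) r) 0 < e"
          unfolding X_def[symmetric] by simp
      qed
    qed
  qed
  ultimately show ?thesis unfolding almost_SO2_reducible_def by blast
qed

end

theorem theoremB:
  fixes \<Gamma> :: "(complex \<Rightarrow> complex) set"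
    and d :: "(complex \<Rightarrow> complex) \<Rightarrow> (complex \<Rightarrow> complex) \<Rightarrow> real"
  assumes metric: "left_invariant_Moebius_metric d"
    and subgroup: "subgroup \<Gamma> circle_group"
    and diffeos: "\<Gamma> \<subseteq> C2_circle_diffeos"
    and abelian: "comm_group (circle_group\<lparr>carrier := \<Gamma>\<rparr>)"
    and fin_gen: "\<exists>A. finite A \<and> A \<subseteq> \<Gamma> \<and> generate circle_group A = \<Gamma>"
    and free: "\<And>f z. f \<in> \<Gamma> \<Longrightarrow> f \<noteq> \<one>\<^bsub>circle_group\<^esub> \<Longrightarrow> z \<in> circle \<Longrightarrow> f z \<noteq> z"
  shows "almost_SO2_reducible d \<Gamma> projective_derivative"
proof -
  interpret free_C2_circle_group \<Gamma>
    using subgroup diffeos free by (rule free_C2_circle_group.intro)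
  have comm: "f \<otimes>\<^bsub>circle_group\<^esub> g = g \<otimes>\<^bsub>circle_group\<^esub> f" if "f \<in> \<Gamma>" "g \<in> \<Gamma>" for f g
    using comm_monoid.m_comm[OF comm_group.axioms(1)[OF abelian], of f g] that by simp
  obtain A where "finite A" "A \<subseteq> \<Gamma>" "generate circle_group A = \<Gamma>"
    using fin_gen by blast
  from log_deriv_asymptotic_coboundary[OF comm this]
  obtain u :: "nat \<Rightarrow> complex \<Rightarrow> real" where "\<forall>n. continuous_on circle (u n)"
    "\<forall>f\<in>\<Gamma>. uniform_limit circle (\<lambda>n z. log_deriv f z + u n (f z) - u n z) (\<lambda>_. 0) sequentially"
    by blast
  then show ?thesis by (rule almost_reducible[OF metric])
qed

end
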